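(* Let $\Omega\subset\mathbb R^2$ be a planar domain with smooth boundary $K=\partial\Omega$. As $w\in\mathrm{int}(\Omega)$ approaches the boundary $K$ from inside, the behavior of $V(w,\Omega)$ is expressed in terms of $\delta=d(w,K)$ by $$V(w,\Omega)=-\left(\frac{\pi}{4\delta^2}+\frac{\kappa\pi}{4\delta}\right)+O(1),$$ where $\kappa$ is the curvature of $K$ at the point of $K$ closest to $w$.
   Context: For $w$ in the interior of $\Omega$, the renormalized $r^{-4}$-potential is $V(w,\Omega)=\lim_{\varepsilon\to0}\Big(\int_{\Omega\setminus B_\varepsilon(w)}\frac{d^2z}{|z-w|^4}-\frac{\pi}{\varepsilon^2}\Big)$, where $d^2z$ is the area element of $\mathbb R^2$ and $B_\varepsilon(w)$ is the disc of center $w$ and radius $\varepsilon$. The curvature $\kappa$ of $K$ is signed, with respect to the orientation of $K$ as the boundary of $\Omega$ (so $\kappa>0$ for the boundary of a round disc $\Omega$). *)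

theory Defs
  imports "HOL-Analysis.Analysis" "HOL-Library.Landau_Symbols"
begin

definition C_infinity :: "(real \<Rightarrow> 'a::real_normed_vector) \<Rightarrow> bool" where
  "C_infinity f \<longleftrightarrow>
     (\<forall>k t. (((\<lambda>g s. vector_derivative g (at s)) ^^ k) f) differentiable (at t))"

text \<open>Counterclockwise rotation by a right angle.\<close>

definition rot90 :: "real^2 \<Rightarrow> real^2" where
  "rot90 v = vector [- (v $ 2), v $ 1]"

text \<open>
  Up to a rigid motion, the set coincides near each boundary point with the region above the
  graph of a smooth function, where \<open>e\<close> is the horizontal and \<open>rot90 e\<close> the vertical
  direction. The condition is on the interior and the frontier, so the set may be open, closed,
  or contain only some of its boundary points. Neither boundedness nor connectedness is required.
\<close>

definition smooth_boundary :: "(real^2) set \<Rightarrow> bool" where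
  "smooth_boundary \<Omega> \<longleftrightarrow>
     (\<forall>p \<in> frontier \<Omega>. \<exists>e f. \<exists>r>0. norm e = 1 \<and> C_infinity (f :: real \<Rightarrow> real) \<and>
        (\<forall>z \<in> ball p r.
           (z \<in> interior \<Omega> \<longleftrightarrow> f (e \<bullet> z) < rot90 e \<bullet> z) \<and>
           (z \<in> frontier \<Omega> \<longleftrightarrow> f (e \<bullet> z) = rot90 e \<bullet> z)))"

text \<open>Signed curvature \<open>(x' y'' - y' x'') / (x'\<^sup>2 + y'\<^sup>2)\<^bsup>3/2\<^esup>\<close> of a plane curve.\<close>

definition curve_curvature :: "(real \<Rightarrow> real^2) \<Rightarrow> real \<Rightarrow> real" where
  "curve_curvature \<gamma> t =
     (let v = vector_derivative \<gamma> (at t);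
          a = vector_derivative (\<lambda>s. vector_derivative \<gamma> (at s)) (at t)
      in (v $ 1 * a $ 2 - v $ 2 * a $ 1) / norm v ^ 3)"

text \<open>
  \<open>\<gamma>\<close> is a regular parametrization of the boundary near time \<open>t\<close>, oriented as the
  boundary of \<open>\<Omega>\<close>, that is, with \<open>\<Omega>\<close> on the left.
\<close>

definition oriented_boundary_curve :: "(real^2) set \<Rightarrow> (real \<Rightarrow> real^2) \<Rightarrow> real \<Rightarrow> bool" where
  "oriented_boundary_curve \<Omega> \<gamma> t \<longleftrightarrow>
     C_infinity \<gamma> \<and> vector_derivative \<gamma> (at t) \<noteq> 0 \<and>
     (\<forall>\<^sub>F s in nhds t. \<gamma> s \<in> frontier \<Omega>) \<and>
     (\<forall>\<^sub>F h in at_right 0.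
        \<gamma> t + h *\<^sub>R rot90 (vector_derivative \<gamma> (at t)) \<in> interior \<Omega>)"

definition boundary_curvature :: "(real^2) set \<Rightarrow> real^2 \<Rightarrow> real" where
  "boundary_curvature \<Omega> q =
     (THE k. \<exists>\<gamma> t. oriented_boundary_curve \<Omega> \<gamma> t \<and> \<gamma> t = q \<and> k = curve_curvature \<gamma> t)"

text \<open>
  The integral is over \<open>lebesgue\<close> rather than \<open>lborel\<close> because \<open>\<Omega>\<close> may contain a
  non-Borel part of its boundary.
\<close>

definition renormalized_potential :: "real^2 \<Rightarrow> (real^2) set \<Rightarrow> real" where
  "renormalized_potential w \<Omega> =
     Lim (at_right 0)
       (\<lambda>\<epsilon>. (LINT z:\<Omega> - ball w \<epsilon>|lebesgue. 1 / norm (z - w) ^ 4) - pi / \<epsilon>\<^sup>2)"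

end

theory Submission
  imports Defs
begin

text \<open>
  The integral of \<open>1 / norm (z - w) ^ 4\<close> over the complement of the disc of radius \<open>\<epsilon>\<close> about \<open>w\<close> is
  exactly \<open>pi / \<epsilon>\<^sup>2\<close>, so \<open>V(w, \<Omega>)\<close> is minus the integral over the exterior of \<open>\<Omega>\<close>. Let \<open>q\<close> be
  the boundary point closest to \<open>w\<close>. In the frame at \<open>q\<close> given by the tangent and the inner normal, \<open>w\<close>
  is \<open>(0, \<delta>)\<close>, and the exterior is squeezed near \<open>q\<close> between the regions below the graphs of
  \<open>A u\<^sup>2 + c u\<^sup>3 \<plusminus> C u\<^sup>4\<close> with \<open>2 A = \<kappa>\<close>. The half-plane \<open>v \<le> 0\<close> contributes exactly
  \<open>pi / (4 \<delta>\<^sup>2)\<close>; the region between it and the boundary contributes, up to \<open>O(1)\<close>, the integral of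
  \<open>(A u\<^sup>2 + c u\<^sup>3) / (u\<^sup>2 + \<delta>\<^sup>2)\<^sup>2\<close>, whose quadratic part is \<open>A pi / (2 \<delta>) + O(1)\<close> and whose
  cubic part vanishes by symmetry. All constants depend only on bounds for the first four derivatives of the
  graph function and on the size of the chart.
\<close>

section \<open>The quartic kernel outside a disc and on a half-plane\<close>

text \<open>Passing to the exterior removes both the singularity and the limit: the exterior misses
  the disc of radius \<delta> about \<open>w\<close>, so every later integral converges absolutely.
  The chart is fixed at a boundary point \<open>p\<close>, whereas the frame moves with
  \<open>q\<close>. The moving frame puts \<open>w\<close> on an axis, so the kernel on the tangent
  line is even in u. The fixed chart gives one bound M for the derivatives at all \<open>q\<close>
  near \<open>p\<close>, hence uniform constants. The boundary is never rewritten as a graph over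
  its tangent: it suffices to know the sign of the height above the chart's graph outside a band of
  width of order u^4. An error of order |u|^k costs the integral of |u|^k / (u^2 + \<delta>^2)^2,
  which stays bounded for k = 4 but not for k = 2 or 3; this fixes the order of the Taylor
  expansion. As for the sign of the curvature term: near the boundary of a disc the interior lies
  above a convex graph, so A > 0, and the exterior gains the sliver between tangent and
  boundary.\<close>

lemma emeasure_annulus:
  fixes w :: "'a::euclidean_space"
  assumes "DIM('a) = 2" "0 < \<epsilon>" "\<epsilon> \<le> s"
  shows "emeasure lborel (cball w s - ball w \<epsilon>) = ennreal (pi * (s\<^sup>2 - \<epsilon>\<^sup>2))"
proof -
  have "emeasure lborel (cball w s - ball w \<epsilon>) = emeasure lborel (cball w s) - emeasure lborel (ball w \<epsilon>)"
    using assms by (intro emeasure_Diff) (auto simp: emeasure_ball)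
  also have "\<dots> = ennreal (pi * s\<^sup>2) - ennreal (pi * \<epsilon>\<^sup>2)"
    using assms by (simp add: emeasure_ball emeasure_cball unit_ball_vol_2)
  finally show ?thesis
    by (simp add: ennreal_minus right_diff_distrib)
qed

text \<open>Layer cake in place of polar coordinates: \<open>1 / a ^ 4\<close> is the integral of
  \<open>4 / s ^ 5\<close> over s \<ge> a, and exchanging the two integrals leaves the areas of
  annuli between the radii \<epsilon> and s. The type is an arbitrary Euclidean plane because the
  value serves both in \<open>real^2\<close> and in \<open>real \<times> real\<close>.\<close>

lemma nn_integral_inverse_fourth_power_outside_ball:
  fixes w :: "'a::euclidean_space"
  assumes dim: "DIM('a) = 2" and \<epsilon>: "0 < \<epsilon>"
  shows "(\<integral>\<^sup>+z. ennreal (1 / norm (z - w) ^ 4) * indicator (- ball w \<epsilon>) z \<partial>lborel) = ennreal (pi / \<epsilon>\<^sup>2)"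
proof -
  let ?f = "\<lambda>(z::'a, s::real). ennreal (4 / s ^ 5) * indicator {p. \<epsilon> \<le> norm (fst p - w) \<and> norm (fst p - w) \<le> snd p} (z, s)"
  have *: "(\<integral>\<^sup>+s. ennreal (4 / s ^ 5) * indicator {a..} s \<partial>lborel) = ennreal (1 / a ^ 4)" if "0 < a" for a :: real
  proof -
    have "(\<integral>\<^sup>+s. ennreal (4 / s ^ 5) * indicator {a..} s \<partial>lborel) = ennreal (0 - (- 1 / a ^ 4))"
    proof (rule nn_integral_FTC_atLeast)
      fix x :: real assume x: "a \<le> x"
      then have "x \<noteq> 0" using that by simp
      then show "((\<lambda>x. - 1 / x ^ 4) has_real_derivative 4 / x ^ 5) (at x)"
        by (auto intro!: derivative_eq_intros simp: field_simps eval_nat_numeral)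
      show "0 \<le> 4 / x ^ 5" using x that by simp
    next
      have "((\<lambda>x::real. - 1 * inverse x ^ 4) \<longlongrightarrow> - 1 * 0 ^ 4) at_top"
        by (intro tendsto_intros tendsto_inverse_0_at_top filterlim_ident)
      then show "((\<lambda>x::real. - 1 / x ^ 4) \<longlongrightarrow> 0) at_top"
        by (simp add: field_simps)
    qed measurable
    then show ?thesis by simp
  qed
  have meas: "?f \<in> borel_measurable (lborel \<Otimes>\<^sub>M lborel)"
  proof -
    have "closed {p::'a\<times>real. \<epsilon> \<le> norm (fst p - w) \<and> norm (fst p - w) \<le> snd p}"
      by (intro closed_Collect_conj closed_Collect_le continuous_intros)
    then have [measurable]: "{p::'a\<times>real. \<epsilon> \<le> norm (fst p - w) \<and> norm (fst p - w) \<le> snd p} \<in> sets (borel \<Otimes>\<^sub>M borel)"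
      unfolding borel_prod by (rule borel_closed)
    show ?thesis by measurable
  qed
  have "(\<integral>\<^sup>+z. ennreal (1 / norm (z - w) ^ 4) * indicator (- ball w \<epsilon>) z \<partial>lborel) = (\<integral>\<^sup>+z. (\<integral>\<^sup>+s. ?f (z, s) \<partial>lborel) \<partial>lborel)"
  proof (intro nn_integral_cong)
    fix z :: 'a
    show "ennreal (1 / norm (z - w) ^ 4) * indicator (- ball w \<epsilon>) z = (\<integral>\<^sup>+s. ?f (z, s) \<partial>lborel)"
    proof (cases "\<epsilon> \<le> norm (z - w)")
      case True
      then have "(\<integral>\<^sup>+s. ?f (z, s) \<partial>lborel) = (\<integral>\<^sup>+s. ennreal (4 / s ^ 5) * indicator {norm (z - w)..} s \<partial>lborel)"
        by (intro nn_integral_cong) (auto simp: indicator_def)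
      also have "\<dots> = ennreal (1 / norm (z - w) ^ 4)"
        using True \<epsilon> by (intro *) auto
      finally show ?thesis using True by (simp add: dist_norm norm_minus_commute)
    next
      case False
      then show ?thesis by (simp add: dist_norm norm_minus_commute)
    qed
  qed
  also have "\<dots> = (\<integral>\<^sup>+s. (\<integral>\<^sup>+z. ?f (z, s) \<partial>lborel) \<partial>lborel)"
    using lborel_pair.Fubini'[OF meas, symmetric] by simp
  also have "\<dots> = (\<integral>\<^sup>+s. ennreal (4 / s ^ 5 * (pi * (s\<^sup>2 - \<epsilon>\<^sup>2))) * indicator {\<epsilon>..} s \<partial>lborel)"
  proof (intro nn_integral_cong)
    fix s :: real
    have "(\<integral>\<^sup>+z. ?f (z, s) \<partial>lborel) = (\<integral>\<^sup>+z. ennreal (4 / s ^ 5) * indicator (cball w s - ball w \<epsilon>) z \<partial>lborel)"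
      by (intro nn_integral_cong) (auto simp: indicator_def dist_norm norm_minus_commute)
    also have "\<dots> = ennreal (4 / s ^ 5) * emeasure lborel (cball w s - ball w \<epsilon>)"
      by (intro nn_integral_cmult_indicator) simp
    also have "\<dots> = ennreal (4 / s ^ 5 * (pi * (s\<^sup>2 - \<epsilon>\<^sup>2))) * indicator {\<epsilon>..} s"
    proof (cases "\<epsilon> \<le> s")
      case True
      then show ?thesis
        using \<epsilon> dim by (simp add: emeasure_annulus ennreal_mult'[symmetric] del: times_divide_eq_left)
    next
      case False
      then have E: "cball w s - ball w \<epsilon> = {}" by auto
      show ?thesis unfolding E using False by simp
    qed
    finally show "(\<integral>\<^sup>+z. ?f (z, s) \<partial>lborel) = \<dots>" .
  qed
  also have "\<dots> = ennreal (0 - (- 2 * pi / \<epsilon>\<^sup>2 + pi * \<epsilon>\<^sup>2 / \<epsilon> ^ 4))"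
  proof (rule nn_integral_FTC_atLeast[where F="\<lambda>x. - 2 * pi / x\<^sup>2 + pi * \<epsilon>\<^sup>2 / x ^ 4"])
    fix x :: real assume x: "\<epsilon> \<le> x"
    then have "x \<noteq> 0" using \<epsilon> by simp
    then show "((\<lambda>x. - 2 * pi / x\<^sup>2 + pi * \<epsilon>\<^sup>2 / x ^ 4) has_real_derivative 4 / x ^ 5 * (pi * (x\<^sup>2 - \<epsilon>\<^sup>2))) (at x)"
      by (auto intro!: derivative_eq_intros simp: field_simps eval_nat_numeral)
    have "\<epsilon>\<^sup>2 \<le> x\<^sup>2" using x \<epsilon> by (intro power_mono) auto
    then show "0 \<le> 4 / x ^ 5 * (pi * (x\<^sup>2 - \<epsilon>\<^sup>2))" using x \<epsilon> by simp
  next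
    have "((\<lambda>x::real. - 2 * pi * inverse x ^ 2 + pi * \<epsilon>\<^sup>2 * inverse x ^ 4) \<longlongrightarrow> - 2 * pi * 0 ^ 2 + pi * \<epsilon>\<^sup>2 * 0 ^ 4) at_top"
      by (intro tendsto_intros tendsto_inverse_0_at_top filterlim_ident)
    then show "((\<lambda>x. - 2 * pi / x\<^sup>2 + pi * \<epsilon>\<^sup>2 / x ^ 4) \<longlongrightarrow> 0) at_top"
      by (simp add: field_simps)
  qed measurable
  also have "\<dots> = ennreal (pi / \<epsilon>\<^sup>2)"
    using \<epsilon> by (simp add: field_simps eval_nat_numeral)
  finally show ?thesis .
qed

lemma has_integral_inverse_fourth_power_outside_ball:
  fixes w :: "'a::euclidean_space"
  assumes dim: "DIM('a) = 2" and \<epsilon>: "0 < \<epsilon>"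
  shows "has_bochner_integral lborel (\<lambda>z. indicator (- ball w \<epsilon>) z * (1 / norm (z - w) ^ 4)) (pi / \<epsilon>\<^sup>2)"
proof (rule has_bochner_integral_nn_integral)
  have "(\<integral>\<^sup>+z. ennreal (indicator (- ball w \<epsilon>) z * (1 / norm (z - w) ^ 4)) \<partial>lborel)
      = (\<integral>\<^sup>+z. ennreal (1 / norm (z - w) ^ 4) * indicator (- ball w \<epsilon>) z \<partial>lborel)"
    by (intro nn_integral_cong) (auto simp: indicator_def)
  then show "(\<integral>\<^sup>+z. ennreal (indicator (- ball w \<epsilon>) z * (1 / norm (z - w) ^ 4)) \<partial>lborel) = ennreal (pi / \<epsilon>\<^sup>2)"
    using nn_integral_inverse_fourth_power_outside_ball[OF assms] by simp
qed (use \<epsilon> in auto)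

section \<open>One-dimensional integrals and the half-plane\<close>

lemma nn_integral_even:
  fixes f :: "real \<Rightarrow> ennreal"
  assumes [measurable]: "f \<in> borel_measurable borel" and even: "\<And>x. f (- x) = f x"
  shows "(\<integral>\<^sup>+x. f x \<partial>lborel) = 2 * (\<integral>\<^sup>+x. f x * indicator {0..} x \<partial>lborel)"
proof -
  have "(\<integral>\<^sup>+x. f x \<partial>lborel) = (\<integral>\<^sup>+x. f x * indicator {0..} x + f x * indicator {..<0} x \<partial>lborel)"
    by (intro nn_integral_cong) (auto simp: indicator_def)
  also have "\<dots> = (\<integral>\<^sup>+x. f x * indicator {0..} x \<partial>lborel) + (\<integral>\<^sup>+x. f x * indicator {..<0} x \<partial>lborel)"
    by (intro nn_integral_add) measurable
  also have "(\<integral>\<^sup>+x. f x * indicator {..<0} x \<partial>lborel) = (\<integral>\<^sup>+x. f x * indicator {0<..} x \<partial>lborel)"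
    by (subst nn_integral_real_affine[where c="-1" and t=0])
      (auto simp: even indicator_def intro!: nn_integral_cong)
  also have "\<dots> = (\<integral>\<^sup>+x. f x * indicator {0..} x \<partial>lborel)"
    using AE_lborel_singleton[of "0::real"]
    by (intro nn_integral_cong_AE) (auto simp: indicator_def elim!: eventually_mono)
  finally show ?thesis by (simp add: mult_2)
qed

lemma has_real_derivative_arctan_divide:
  fixes s u :: real
  assumes "0 < s"
  shows "((\<lambda>u. arctan (u / s)) has_real_derivative s / (u\<^sup>2 + s\<^sup>2)) (at u)"
proof -
  have "((\<lambda>u. arctan (u / s)) has_real_derivative inverse (1 + (u / s)\<^sup>2) * (1 / s)) (at u)"
    using assms by (auto intro!: derivative_eq_intros)
  moreover have "1 + (u / s)\<^sup>2 = (u\<^sup>2 + s\<^sup>2) / s\<^sup>2"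
    using assms by (simp add: field_simps)
  then have "inverse (1 + (u / s)\<^sup>2) * (1 / s) = s / (u\<^sup>2 + s\<^sup>2)"
    using assms by (simp add: power2_eq_square)
  ultimately show ?thesis by simp
qed

lemma nn_integral_square_Cauchy_kernel:
  fixes s :: real
  assumes "0 < s"
  shows "(\<integral>\<^sup>+u. ennreal (1 / (u\<^sup>2 + s\<^sup>2)\<^sup>2) \<partial>lborel) = ennreal (pi / (2 * s ^ 3))"
proof -
  \<comment> \<open>The reduction formula for the squared Cauchy kernel. It vanishes at 0 and tends
    to pi / (4 s^3), half of the value on the whole line.\<close>
  let ?F = "\<lambda>u. 1 / (2 * s ^ 3) * (arctan (u / s) + s * (u / (u\<^sup>2 + s\<^sup>2)))"
  have "(\<integral>\<^sup>+u. ennreal (1 / (u\<^sup>2 + s\<^sup>2)\<^sup>2) * indicator {0..} u \<partial>lborel)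
      = ennreal (1 / (2 * s ^ 3) * (pi / 2 + s * 0) - ?F 0)"
  proof (rule nn_integral_FTC_atLeast)
    fix u :: real
    have pos: "u\<^sup>2 + s\<^sup>2 > 0" "u\<^sup>2 + s\<^sup>2 \<noteq> 0" using assms by (auto simp: sum_power2_gt_zero_iff)
    have D1: "((\<lambda>u. arctan (u / s)) has_real_derivative s / (u\<^sup>2 + s\<^sup>2)) (at u)"
      using assms by (rule has_real_derivative_arctan_divide)
    have D2: "((\<lambda>u. u / (u\<^sup>2 + s\<^sup>2)) has_real_derivative (s\<^sup>2 - u\<^sup>2) / (u\<^sup>2 + s\<^sup>2)\<^sup>2) (at u)"
      using pos by (auto intro!: derivative_eq_intros simp: power2_eq_square algebra_simps)
    have "(?F has_real_derivative 1 / (2 * s ^ 3) * (s / (u\<^sup>2 + s\<^sup>2) + s * ((s\<^sup>2 - u\<^sup>2) / (u\<^sup>2 + s\<^sup>2)\<^sup>2))) (at u)"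
      by (intro DERIV_cmult DERIV_add D1 D2)
    moreover have "1 / (2 * s ^ 3) * (s / (u\<^sup>2 + s\<^sup>2) + s * ((s\<^sup>2 - u\<^sup>2) / (u\<^sup>2 + s\<^sup>2)\<^sup>2)) = 1 / (u\<^sup>2 + s\<^sup>2)\<^sup>2"
    proof -
      have "s / (u\<^sup>2 + s\<^sup>2) = s * (u\<^sup>2 + s\<^sup>2) / (u\<^sup>2 + s\<^sup>2)\<^sup>2"
        using pos by (simp add: power2_eq_square)
      then have "s / (u\<^sup>2 + s\<^sup>2) + s * ((s\<^sup>2 - u\<^sup>2) / (u\<^sup>2 + s\<^sup>2)\<^sup>2) = 2 * s ^ 3 / (u\<^sup>2 + s\<^sup>2)\<^sup>2"
        by (simp add: add_divide_distrib[symmetric]) (simp add: power2_eq_square power3_eq_cube algebra_simps)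
      then show ?thesis using assms by simp
    qed
    ultimately show "(?F has_real_derivative 1 / (u\<^sup>2 + s\<^sup>2)\<^sup>2) (at u)" by simp
  next
    have "((\<lambda>u. u / (u\<^sup>2 + s\<^sup>2)) \<longlongrightarrow> 0) at_top"
    proof (rule Lim_null_comparison)
      show "((\<lambda>u::real. inverse u) \<longlongrightarrow> 0) at_top" by (intro tendsto_inverse_0_at_top filterlim_ident)
      show "\<forall>\<^sub>F u in at_top. norm (u / (u\<^sup>2 + s\<^sup>2)) \<le> inverse u"
        using eventually_gt_at_top[of 0]
      proof eventually_elim
        case (elim u)
        have "u * u \<le> u\<^sup>2 + s\<^sup>2" by (simp add: power2_eq_square)
        moreover have "u\<^sup>2 + s\<^sup>2 > 0" using elim by (simp add: add_pos_nonneg)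
        ultimately show ?case using elim by (simp add: field_simps)
      qed
    qed
    moreover have "((\<lambda>u. arctan (u / s)) \<longlongrightarrow> pi / 2) at_top"
    proof (rule filterlim_compose[OF tendsto_arctan_at_top])
      show "LIM u at_top. u / s :> at_top"
        using filterlim_at_top_mult_tendsto_pos[of "\<lambda>_. 1 / s" "1 / s" at_top "\<lambda>u::real. u"] assms
        by (simp add: filterlim_ident)
    qed
    ultimately show "(?F \<longlongrightarrow> 1 / (2 * s ^ 3) * (pi / 2 + s * 0)) at_top"
      by (intro tendsto_intros)
  qed auto
  moreover have "(\<integral>\<^sup>+u. ennreal (1 / (u\<^sup>2 + s\<^sup>2)\<^sup>2) \<partial>lborel)
     = 2 * (\<integral>\<^sup>+u. ennreal (1 / (u\<^sup>2 + s\<^sup>2)\<^sup>2) * indicator {0..} u \<partial>lborel)"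
    by (rule nn_integral_even) auto
  ultimately show ?thesis
    using assms by (simp add: ennreal_mult'[symmetric] flip: ennreal_numeral)
qed

text \<open>Lines parallel to the boundary are integrated first: the line at height v has distance s
  = \<delta> - v \<ge> \<delta> > 0 from the pole and contributes pi / (2 s^3), which is then
  integrated over s \<ge> \<delta>.\<close>

lemma nn_integral_quartic_kernel_half_plane:
  fixes \<delta> :: real
  assumes "0 < \<delta>"
  shows "(\<integral>\<^sup>+(u, v). ennreal (1 / (u\<^sup>2 + (v - \<delta>)\<^sup>2)\<^sup>2) * indicator {..0} v \<partial>lborel) = ennreal (pi / (4 * \<delta>\<^sup>2))"
proof -
  have meas: "(\<lambda>(u, v). ennreal (1 / (u\<^sup>2 + (v - \<delta>)\<^sup>2)\<^sup>2) * indicator {..0} v) \<in> borel_measurable (lborel \<Otimes>\<^sub>M lborel)"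
    by measurable
  have "(\<integral>\<^sup>+(u, v). ennreal (1 / (u\<^sup>2 + (v - \<delta>)\<^sup>2)\<^sup>2) * indicator {..0} v \<partial>lborel)
     = (\<integral>\<^sup>+v. (\<integral>\<^sup>+u. ennreal (1 / (u\<^sup>2 + (v - \<delta>)\<^sup>2)\<^sup>2) * indicator {..0} v \<partial>lborel) \<partial>lborel)"
    using lborel_pair.nn_integral_snd[OF meas] by (simp add: lborel_prod)
  also have "\<dots> = (\<integral>\<^sup>+v. ennreal (pi / (2 * (\<delta> - v) ^ 3)) * indicator {..0} v \<partial>lborel)"
  proof (intro nn_integral_cong)
    fix v :: real
    show "(\<integral>\<^sup>+u. ennreal (1 / (u\<^sup>2 + (v - \<delta>)\<^sup>2)\<^sup>2) * indicator {..0} v \<partial>lborel) = ennreal (pi / (2 * (\<delta> - v) ^ 3)) * indicator {..0} v"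
      using nn_integral_square_Cauchy_kernel[of "\<delta> - v"] assms
      by (cases "v \<le> 0") (auto simp: power2_commute)
  qed
  also have "\<dots> = (\<integral>\<^sup>+s. ennreal (pi / (2 * s ^ 3)) * indicator {\<delta>..} s \<partial>lborel)"
    by (subst nn_integral_real_affine[where c="-1" and t=\<delta>]) (auto simp: indicator_def intro!: nn_integral_cong)
  also have "\<dots> = ennreal (0 - (- pi / (4 * \<delta>\<^sup>2)))"
  proof (rule nn_integral_FTC_atLeast)
    fix x :: real assume x: "\<delta> \<le> x"
    then have "x \<noteq> 0" using assms by simp
    then show "((\<lambda>x. - pi / (4 * x\<^sup>2)) has_real_derivative pi / (2 * x ^ 3)) (at x)"
      by (auto intro!: derivative_eq_intros simp: field_simps eval_nat_numeral)
    show "0 \<le> pi / (2 * x ^ 3)" using x assms by simp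
  next
    have "((\<lambda>x::real. - (pi / 4) * inverse x ^ 2) \<longlongrightarrow> - (pi / 4) * 0 ^ 2) at_top"
      by (intro tendsto_intros tendsto_inverse_0_at_top filterlim_ident)
    then show "((\<lambda>x::real. - pi / (4 * x\<^sup>2)) \<longlongrightarrow> 0) at_top"
      by (simp add: field_simps)
  qed measurable
  finally show ?thesis by simp
qed

section \<open>Regions bounded by nearly parabolic graphs\<close>

text \<open>
  On the range of \<open>v\<close> that matters the kernel is close to its value \<open>1 / a\<^sup>2\<close> on the
  tangent line \<open>v = 0\<close>, so a vertical section contributes its signed length \<open>g\<close> times that value.
\<close>

lemma graph_section_estimate:
  fixes S :: "real set" and u \<delta> \<rho> C A c :: real
  defines "a \<equiv> u\<^sup>2 + \<delta>\<^sup>2" and "g \<equiv> A * u\<^sup>2 + c * u ^ 3"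
  assumes C: "1 \<le> C" and \<rho>: "12 * C * \<rho> \<le> 1" and u: "\<bar>u\<bar> \<le> \<rho>" and \<delta>: "0 < \<delta>"
    and A: "\<bar>A\<bar> \<le> C" and c: "\<bar>c\<bar> \<le> C"
    and S [measurable]: "S \<in> sets borel"
    and above: "\<And>v. \<bar>v\<bar> \<le> \<rho> \<Longrightarrow> g + C * u ^ 4 < v \<Longrightarrow> v \<notin> S"
    and below: "\<And>v. \<bar>v\<bar> \<le> \<rho> \<Longrightarrow> v < g - C * u ^ 4 \<Longrightarrow> v \<in> S"
  shows "\<bar>(\<integral>v. indicator {- \<rho>..\<rho>} v * (indicator S v - indicator {..0} v) * (1 / (u\<^sup>2 + (v - \<delta>)\<^sup>2)\<^sup>2) \<partial>lborel) - g / a\<^sup>2\<bar>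
    \<le> 1000 * C ^ 3 * (1 + \<delta> / a)"
proof -
  define e where "e = C * u ^ 4"
  define \<phi> where "\<phi> v = 1 / (u\<^sup>2 + (v - \<delta>)\<^sup>2)\<^sup>2" for v
  \<comment> \<open>\<open>3 * C\<close> because \<bar>g\<bar> \<le> 2 C u^2 and e \<le> C u^2:
    everything uncertain happens at heights \<bar>v\<bar> \<le> k u^2, which is at most
    \<bar>u\<bar> / 4 by the smallness of \<rho>.\<close>
  define k where "k = 3 * C"
  define m where "m = 6 * (2 * k * \<delta> + k\<^sup>2 * u\<^sup>2) / a\<^sup>2"
  define \<eta> where "\<eta> v = indicator {- \<rho>..\<rho>} v * (indicator S v - indicator {..0} v :: real)" for v
  \<comment> \<open>The signed segment between 0 and \<open>g\<close>: its integral is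
    \<open>g\<close> for either sign of \<open>g\<close>.\<close>
  define \<psi> where "\<psi> v = (indicator {..g} v - indicator {..0} v :: real)" for v
  \<comment> \<open>Two sources of error: on the band of half-width \<open>e\<close> the set
    \<open>S\<close> is unknown, and there the kernel is at most \<open>4 / a\<^sup>2\<close>;
    between 0 and \<open>g\<close> the kernel is replaced by its value at v = 0, at a cost of at
    most \<open>m\<close>.\<close>
  define D where "D v = indicator {g - e..g + e} v * (4 / a\<^sup>2) + indicator {- \<bar>g\<bar>..\<bar>g\<bar>} v * m" for v
  have \<rho>1: "\<rho> \<le> 1"
  proof -
    have "0 \<le> \<rho>" using u by linarith
    then have "1 * \<rho> \<le> 12 * C * \<rho>" using C by (intro mult_right_mono) auto
    then show ?thesis using \<rho> by linarith
  qed
  have a: "0 < a" using \<delta> by (simp add: a_def add_nonneg_pos)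
  have k: "3 \<le> k" "k * \<bar>u\<bar> \<le> 1 / 4"
  proof -
    have "k * \<bar>u\<bar> \<le> k * \<rho>" using u C by (intro mult_left_mono) (auto simp: k_def)
    then show "k * \<bar>u\<bar> \<le> 1 / 4" using \<rho> by (simp add: k_def)
  qed (use C in \<open>simp add: k_def\<close>)
  have u2: "u\<^sup>2 \<le> a" by (simp add: a_def)
  have u3: "\<bar>u\<bar> ^ 3 \<le> u\<^sup>2" "u ^ 4 \<le> u\<^sup>2"
    using power_decreasing[of 2 3 "\<bar>u\<bar>"] power_decreasing[of 2 4 "\<bar>u\<bar>"] u \<rho>1 by auto
  have e0: "0 \<le> e" using C by (simp add: e_def)
  have "\<bar>g\<bar> \<le> C * u\<^sup>2 + C * \<bar>u\<bar> ^ 3"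
  proof -
    have "\<bar>A * u\<^sup>2\<bar> \<le> C * u\<^sup>2" "\<bar>c * u ^ 3\<bar> \<le> C * \<bar>u\<bar> ^ 3"
      using A c by (auto simp: abs_mult power_abs intro!: mult_right_mono)
    then show ?thesis unfolding g_def by linarith
  qed
  also have "C * \<bar>u\<bar> ^ 3 \<le> C * u\<^sup>2" using u3 C by (intro mult_left_mono) auto
  finally have g2: "\<bar>g\<bar> \<le> 2 * C * u\<^sup>2" by simp
  have eu: "e \<le> C * u\<^sup>2" unfolding e_def using u3 C by (intro mult_left_mono) auto
  have ge: "\<bar>g\<bar> + e \<le> k * u\<^sup>2" using g2 eu by (simp add: k_def)
  have ku: "k * u\<^sup>2 \<le> \<bar>u\<bar> / 4"
  proof -
    have "k * u\<^sup>2 = k * \<bar>u\<bar> * \<bar>u\<bar>" by (simp add: power2_eq_square mult.assoc)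
    also have "\<dots> \<le> 1 / 4 * \<bar>u\<bar>" using k by (intro mult_right_mono) auto
    finally show ?thesis by simp
  qed
  have \<phi>_bounds: "0 \<le> \<phi> v" "\<phi> v \<le> 4 / a\<^sup>2" "\<bar>\<phi> v - 1 / a\<^sup>2\<bar> \<le> m" if v: "\<bar>v\<bar> \<le> k * u\<^sup>2" for v
  proof -
    let ?b = "u\<^sup>2 + (v - \<delta>)\<^sup>2"
    have "\<bar>v\<bar> \<le> \<bar>u\<bar> / 4" using v ku by linarith
    then have "\<bar>v\<bar>\<^sup>2 \<le> (\<bar>u\<bar> / 4)\<^sup>2" by (intro power_mono) auto
    then have "v\<^sup>2 \<le> u\<^sup>2 / 16" by (simp add: power_divide)
    moreover have "4 * (v * \<delta>) \<le> \<delta>\<^sup>2 + 4 * v\<^sup>2"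
      using zero_le_power2[of "\<delta> - 2 * v"] by (simp add: power2_eq_square algebra_simps)
    moreover have "(v - \<delta>)\<^sup>2 = v\<^sup>2 - 2 * (v * \<delta>) + \<delta>\<^sup>2"
      by (simp add: power2_eq_square algebra_simps)
    \<comment> \<open>At the relevant heights the squared distance is comparable with
      \<open>a\<close>: the cross term 2 v \<delta> takes at most \<delta>^2 / 2 + 2 v^2, and v^2
      \<le> u^2 / 16.\<close>
    ultimately have b: "a / 2 \<le> ?b" using zero_le_power2[of u] unfolding a_def by argo
    then have b0: "0 < ?b" using a by linarith
    have "(a / 2)\<^sup>2 \<le> ?b\<^sup>2" using b a by (intro power_mono) auto
    then have "1 / ?b\<^sup>2 \<le> 1 / (a / 2)\<^sup>2" using a by (intro frac_le) auto
    then show "\<phi> v \<le> 4 / a\<^sup>2" by (simp add: \<phi>_def power_divide)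
    show "0 \<le> \<phi> v" by (simp add: \<phi>_def)
    have ib: "1 / ?b \<le> 2 / a" using a b b0 by (simp add: field_simps)
    have ib2: "1 / ?b\<^sup>2 \<le> 4 / a\<^sup>2" using \<open>\<phi> v \<le> 4 / a\<^sup>2\<close> by (simp add: \<phi>_def)
    have "1 / y\<^sup>2 - 1 / x\<^sup>2 = (x - y) * (1 / x * (1 / y\<^sup>2) + 1 / x\<^sup>2 * (1 / y))" if "0 < x" "0 < y" for x y :: real
      using that by (simp add: field_simps power2_eq_square)
    then have "\<phi> v - 1 / a\<^sup>2 = (a - ?b) * (1 / a * (1 / ?b\<^sup>2) + 1 / a\<^sup>2 * (1 / ?b))"
      unfolding \<phi>_def using a b0 by blast
    then have "\<bar>\<phi> v - 1 / a\<^sup>2\<bar> = \<bar>a - ?b\<bar> * (1 / a * (1 / ?b\<^sup>2) + 1 / a\<^sup>2 * (1 / ?b))"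
      using a b0 by (simp add: abs_mult)
    also have "\<dots> \<le> \<bar>a - ?b\<bar> * (1 / a * (4 / a\<^sup>2) + 1 / a\<^sup>2 * (2 / a))"
      using ib ib2 a by (intro mult_left_mono add_mono) auto
    also have "\<dots> = \<bar>a - ?b\<bar> * (6 / a ^ 3)"
      using a by (simp add: field_simps eval_nat_numeral)
    also have "\<bar>a - ?b\<bar> \<le> (2 * k * \<delta> + k\<^sup>2 * u\<^sup>2) * u\<^sup>2"
    proof -
      have "a - ?b = 2 * \<delta> * v - v\<^sup>2" by (simp add: a_def power2_diff)
      then have "\<bar>a - ?b\<bar> \<le> 2 * \<delta> * \<bar>v\<bar> + \<bar>v\<bar>\<^sup>2"
        using abs_triangle_ineq4[of "2 * \<delta> * v" "v\<^sup>2"] \<delta> by (simp add: abs_mult)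
      also have "\<dots> \<le> 2 * \<delta> * (k * u\<^sup>2) + (k * u\<^sup>2)\<^sup>2"
        using v \<delta> by (intro add_mono mult_left_mono power_mono) auto
      finally show ?thesis by (simp add: power2_eq_square algebra_simps)
    qed
    then have "\<bar>a - ?b\<bar> * (6 / a ^ 3) \<le> (2 * k * \<delta> + k\<^sup>2 * u\<^sup>2) * u\<^sup>2 * (6 / a ^ 3)"
      using a by (intro mult_right_mono) auto
    also have "\<dots> \<le> (2 * k * \<delta> + k\<^sup>2 * u\<^sup>2) * a * (6 / a ^ 3)"
      using a u2 k \<delta> by (intro mult_right_mono mult_left_mono) auto
    also have "\<dots> = m" using a by (simp add: m_def field_simps eval_nat_numeral)
    finally show "\<bar>\<phi> v - 1 / a\<^sup>2\<bar> \<le> m" .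
  qed
  have m0: "0 \<le> m" using k \<delta> by (simp add: m_def)
  have k\<rho>: "k * u\<^sup>2 \<le> \<rho>" using ku u by linarith
  have bound: "norm (\<eta> v * \<phi> v - \<psi> v / a\<^sup>2) \<le> D v" for v
  proof -
    have D0: "0 \<le> D v" using m0 by (simp add: D_def)
    have split: "\<eta> v * \<phi> v - \<psi> v / a\<^sup>2 = (\<eta> v - \<psi> v) * \<phi> v + \<psi> v * (\<phi> v - 1 / a\<^sup>2)"
      by (simp add: algebra_simps)
    have \<psi>: "\<bar>\<psi> v\<bar> \<le> indicator {- \<bar>g\<bar>..\<bar>g\<bar>} v" by (auto simp: \<psi>_def indicator_def)
    have 1: "\<bar>\<psi> v * (\<phi> v - 1 / a\<^sup>2)\<bar> \<le> indicator {- \<bar>g\<bar>..\<bar>g\<bar>} v * m"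
    proof (cases "\<bar>v\<bar> \<le> \<bar>g\<bar>")
      case True
      then have "\<bar>v\<bar> \<le> k * u\<^sup>2" using ge e0 by linarith
      then have "\<bar>\<psi> v\<bar> * \<bar>\<phi> v - 1 / a\<^sup>2\<bar> \<le> indicator {- \<bar>g\<bar>..\<bar>g\<bar>} v * m"
        using \<psi> \<phi>_bounds(3) by (intro mult_mono) auto
      then show ?thesis by (simp add: abs_mult)
    next
      case False
      then have "indicator {- \<bar>g\<bar>..\<bar>g\<bar>} v = (0::real)" by (auto simp: indicator_def)
      then show ?thesis using \<psi> by simp
    qed
    have 2: "\<bar>(\<eta> v - \<psi> v) * \<phi> v\<bar> \<le> indicator {g - e..g + e} v * (4 / a\<^sup>2)"
    proof (cases "g - e \<le> v \<and> v \<le> g + e")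
      case True
      then have v: "\<bar>v\<bar> \<le> k * u\<^sup>2" using ge e0 by linarith
      then have "\<bar>\<eta> v - \<psi> v\<bar> \<le> 1"
        using k\<rho> by (auto simp: \<eta>_def \<psi>_def indicator_def)
      then have "\<bar>\<eta> v - \<psi> v\<bar> * \<bar>\<phi> v\<bar> \<le> 1 * (4 / a\<^sup>2)"
        using \<phi>_bounds(1,2)[OF v] by (intro mult_mono) auto
      then show ?thesis using True by (simp add: abs_mult)
    next
      case False
      \<comment> \<open>Inside the window the hypotheses determine \<open>S\<close> off the band.
        Outside it both sides vanish, because \<bar>v\<bar> > \<rho> \<ge> \<bar>g\<bar>.\<close>
      have "\<eta> v = \<psi> v"
      proof (cases "\<bar>v\<bar> \<le> \<rho>")
        case True
        then have "v \<in> S \<longleftrightarrow> v \<le> g"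
          using above[OF True] below[OF True] False e0 unfolding e_def[symmetric] by fastforce
        then show ?thesis using True by (auto simp: \<eta>_def \<psi>_def indicator_def)
      next
        case F: False
        then have "\<not> \<bar>v\<bar> \<le> \<bar>g\<bar>" using k\<rho> ge e0 by linarith
        with F show ?thesis by (auto simp: \<eta>_def \<psi>_def indicator_def)
      qed
      then show ?thesis by simp
    qed
    show ?thesis unfolding split D_def real_norm_def
      using abs_triangle_ineq[of "(\<eta> v - \<psi> v) * \<phi> v" "\<psi> v * (\<phi> v - 1 / a\<^sup>2)"] 1 2 by linarith
  qed
  have \<psi>_int: "has_bochner_integral lborel \<psi> g"
  proof (cases "0 \<le> g")
    case True
    then have "\<psi> = indicator {0<..g}" by (auto simp: \<psi>_def indicator_def fun_eq_iff)
    then show ?thesis using True has_bochner_integral_real_indicator[of "{0<..g}" lborel] by simp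
  next
    case False
    then have "\<psi> = (\<lambda>v. - indicator {g<..0} v)" by (auto simp: \<psi>_def indicator_def fun_eq_iff)
    then show ?thesis
      using False has_bochner_integral_minus[OF has_bochner_integral_real_indicator[of "{g<..0}" lborel]] by simp
  qed
  have D_int: "has_bochner_integral lborel D (2 * e * (4 / a\<^sup>2) + 2 * \<bar>g\<bar> * m)"
  proof -
    have "has_bochner_integral lborel (indicator {g - e..g + e} :: real \<Rightarrow> real) (2 * e)"
      using has_bochner_integral_real_indicator[of "{g - e..g + e}" lborel] e0 by simp
    moreover have "has_bochner_integral lborel (indicator {- \<bar>g\<bar>..\<bar>g\<bar>} :: real \<Rightarrow> real) (2 * \<bar>g\<bar>)"
      using has_bochner_integral_real_indicator[of "{- \<bar>g\<bar>..\<bar>g\<bar>}" lborel] by simp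
    ultimately show ?thesis unfolding D_def
      by (intro has_bochner_integral_add has_bochner_integral_mult_left)
  qed
  have diff_int: "integrable lborel (\<lambda>v. \<eta> v * \<phi> v - \<psi> v / a\<^sup>2)"
  proof (rule Bochner_Integration.integrable_bound)
    show "integrable lborel D" using D_int by (simp add: has_bochner_integral_iff)
    show "(\<lambda>v. \<eta> v * \<phi> v - \<psi> v / a\<^sup>2) \<in> borel_measurable lborel"
      unfolding \<eta>_def \<psi>_def \<phi>_def by measurable
    show "AE v in lborel. norm (\<eta> v * \<phi> v - \<psi> v / a\<^sup>2) \<le> norm (D v)"
      using bound by (intro AE_I2) (smt (verit) real_norm_def)
  qed
  have \<psi>a: "has_bochner_integral lborel (\<lambda>v. \<psi> v / a\<^sup>2) (g / a\<^sup>2)"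
    using \<psi>_int by (rule has_bochner_integral_divide_zero)
  have "(\<integral>v. \<eta> v * \<phi> v - \<psi> v / a\<^sup>2 \<partial>lborel) = (\<integral>v. \<eta> v * \<phi> v \<partial>lborel) - g / a\<^sup>2"
  proof -
    have i2: "integrable lborel (\<lambda>v. \<psi> v / a\<^sup>2)" using \<psi>a by (simp add: has_bochner_integral_iff)
    have "integrable lborel (\<lambda>v. \<eta> v * \<phi> v)"
      using Bochner_Integration.integrable_add[OF diff_int i2] by simp
    then show ?thesis using i2 \<psi>a by (simp add: Bochner_Integration.integral_diff has_bochner_integral_iff)
  qed
  moreover have "norm (\<integral>v. \<eta> v * \<phi> v - \<psi> v / a\<^sup>2 \<partial>lborel) \<le> (\<integral>v. D v \<partial>lborel)"
    using diff_int D_int bound by (intro Bochner_Integration.integral_norm_bound_integral) (auto simp: has_bochner_integral_iff)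
  ultimately have "\<bar>(\<integral>v. \<eta> v * \<phi> v \<partial>lborel) - g / a\<^sup>2\<bar> \<le> 2 * e * (4 / a\<^sup>2) + 2 * \<bar>g\<bar> * m"
    using D_int by (simp add: has_bochner_integral_iff)
  also have "\<dots> \<le> 8 * C + 12 * k * (2 * k * (\<delta> / a) + k\<^sup>2)"
  proof -
    \<comment> \<open>This is what makes a band of width of order u^4 affordable: it contributes a
      bounded amount even when u and \<delta> both tend to 0.\<close>
    have ua: "u ^ 4 / a\<^sup>2 \<le> 1"
    proof -
      have "(u\<^sup>2)\<^sup>2 \<le> a\<^sup>2" using u2 by (intro power_mono) auto
      then show ?thesis using a by simp
    qed
    have "2 * e * (4 / a\<^sup>2) = 8 * C * (u ^ 4 / a\<^sup>2)" by (simp add: e_def)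
    also have "\<dots> \<le> 8 * C * 1" using ua C by (intro mult_left_mono) auto
    finally have 1: "2 * e * (4 / a\<^sup>2) \<le> 8 * C" by simp
    have "2 * \<bar>g\<bar> * m \<le> 2 * (k * u\<^sup>2) * m" using ge e0 m0 by (intro mult_right_mono) auto
    also have "\<dots> = 12 * k * (2 * k * \<delta> * (u\<^sup>2 / a\<^sup>2) + k\<^sup>2 * (u ^ 4 / a\<^sup>2))"
      using a by (simp add: m_def field_simps) 
    also have "\<dots> \<le> 12 * k * (2 * k * \<delta> * (1 / a) + k\<^sup>2 * 1)"
    proof -
      have "u\<^sup>2 / a\<^sup>2 \<le> a / a\<^sup>2" using u2 by (intro divide_right_mono) auto
      also have "\<dots> = 1 / a" using a by (simp add: power2_eq_square)
      finally show ?thesis using ua k \<delta> by (intro mult_left_mono add_mono) auto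
    qed
    finally have "2 * \<bar>g\<bar> * m \<le> 12 * k * (2 * k * (\<delta> / a) + k\<^sup>2)" by (simp only: mult_1_right times_divide_eq_right)
    with 1 show ?thesis by (rule add_mono)
  qed
  \<comment> \<open>The coefficients 8, 216 and 324 come from k = 3 C, and the powers of C are
    rounded up. The ratio \<open>\<delta> / a\<close> is kept, since at u = 0 it equals 1 /
    \<delta>; only its integral over u is bounded.\<close>
  also have "\<dots> \<le> 1000 * C ^ 3 * (1 + \<delta> / a)"
  proof -
    have C3: "C \<le> C ^ 3" "C\<^sup>2 \<le> C ^ 3"
      using power_increasing[of 1 3 C] power_increasing[of 2 3 C] C by auto
    have da: "0 \<le> \<delta> / a" using a \<delta> by simp
    have "8 * C + 12 * k * (2 * k * (\<delta> / a) + k\<^sup>2) = 8 * C + 216 * C\<^sup>2 * (\<delta> / a) + 324 * C ^ 3"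
      by (simp add: k_def power2_eq_square power3_eq_cube algebra_simps)
    also have "\<dots> \<le> 8 * C ^ 3 + 216 * C ^ 3 * (\<delta> / a) + 324 * C ^ 3"
      using C3 da by (intro add_mono mult_left_mono mult_right_mono) auto
    also have "\<dots> \<le> 1000 * C ^ 3 + 1000 * C ^ 3 * (\<delta> / a)"
    proof -
      have "216 * C ^ 3 * (\<delta> / a) \<le> 1000 * C ^ 3 * (\<delta> / a)" using da C by (intro mult_right_mono) auto
      moreover have "0 \<le> C ^ 3" using C by simp
      ultimately show ?thesis by linarith
    qed
    finally show ?thesis by (simp add: algebra_simps)
  qed
  finally show ?thesis by (simp add: \<eta>_def \<phi>_def)
qed

text \<open>The left side is the form in which the differentiation rules deliver the derivative of
  the antiderivative in \<open>integral_cubic_profile\<close>; the denominator is kept opaque as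
  \<open>x\<close> until everything stands over \<open>x\<^sup>2\<close>.\<close>

lemma cubic_profile_identity:
  fixes A c u x \<delta> :: real
  assumes \<delta>: "0 < \<delta>" and that: "x = u\<^sup>2 + \<delta>\<^sup>2" "0 < x"
  shows "A / 2 * (\<delta> / x / \<delta> - (\<delta>\<^sup>2 - u\<^sup>2) / x\<^sup>2) + c / 2 * (2 * u / x + - (\<delta>\<^sup>2 * (2 * u)) / x\<^sup>2)
        = (A * u\<^sup>2 + c * u ^ 3) / x\<^sup>2"
proof -
  have eqs: "\<delta> / x / \<delta> = x / x\<^sup>2" "2 * u / x = 2 * u * x / x\<^sup>2"
    using that(2) \<delta> by (auto simp: power2_eq_square)
  have "A / 2 * (x / y - p / y) + c / 2 * (2 * u * x / y + - q / y) = (A / 2 * (x - p) + c / 2 * (2 * u * x - q)) / y"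
    if "0 < y" for y p q :: real
    using that by (simp add: field_simps)
  then have "A / 2 * (\<delta> / x / \<delta> - (\<delta>\<^sup>2 - u\<^sup>2) / x\<^sup>2) + c / 2 * (2 * u / x + - (\<delta>\<^sup>2 * (2 * u)) / x\<^sup>2)
    = (A / 2 * (x - (\<delta>\<^sup>2 - u\<^sup>2)) + c / 2 * (2 * u * x - \<delta>\<^sup>2 * (2 * u))) / x\<^sup>2"
    unfolding eqs using that(2) by simp
  also have "A / 2 * (x - (\<delta>\<^sup>2 - u\<^sup>2)) + c / 2 * (2 * u * x - \<delta>\<^sup>2 * (2 * u)) = A * u\<^sup>2 + c * u ^ 3"
    unfolding that(1) by (simp add: power2_eq_square power3_eq_cube algebra_simps)
  finally show ?thesis .
qed

text \<open>
  The cubic Taylor term must be kept: it contributes nothing because it is odd, but bounding it by its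
  absolute value would cost an error of order \<open>ln \<delta>\<close>.
\<close>

lemma integral_cubic_profile:
  fixes A c \<delta> \<rho> :: real
  assumes \<delta>: "0 < \<delta>" and \<rho>: "0 < \<rho>"
  shows "has_bochner_integral lborel (\<lambda>u. (A * u\<^sup>2 + c * u ^ 3) / (u\<^sup>2 + \<delta>\<^sup>2)\<^sup>2 * indicator {- \<rho>..\<rho>} u)
           (A * (arctan (\<rho> / \<delta>) / \<delta> - \<rho> / (\<rho>\<^sup>2 + \<delta>\<^sup>2)))"
proof -
  \<comment> \<open>The bracket with factor \<open>A\<close> is odd and doubles between the
    endpoints; the one with factor \<open>c\<close> is even and cancels, which takes the logarithm
    away.\<close>
  let ?F = "\<lambda>u. A / 2 * (arctan (u / \<delta>) / \<delta> - u / (u\<^sup>2 + \<delta>\<^sup>2)) + c / 2 * (ln (u\<^sup>2 + \<delta>\<^sup>2) + \<delta>\<^sup>2 / (u\<^sup>2 + \<delta>\<^sup>2))"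
  have pos: "u\<^sup>2 + \<delta>\<^sup>2 > 0" for u using \<delta> by (simp add: add_nonneg_pos)
  then have nz: "u\<^sup>2 + \<delta>\<^sup>2 \<noteq> 0" for u by (metis less_irrefl)
  have "has_bochner_integral lborel (\<lambda>u. (A * u\<^sup>2 + c * u ^ 3) / (u\<^sup>2 + \<delta>\<^sup>2)\<^sup>2 * indicator {- \<rho>..\<rho>} u) (?F \<rho> - ?F (- \<rho>))"
  proof (rule has_bochner_integral_FTC_Icc_real)
    fix u :: real
    let ?a = "u\<^sup>2 + \<delta>\<^sup>2"
    have D1: "((\<lambda>u. arctan (u / \<delta>)) has_real_derivative \<delta> / ?a) (at u)"
      using \<delta> by (rule has_real_derivative_arctan_divide)
    have D2: "((\<lambda>u. u / (u\<^sup>2 + \<delta>\<^sup>2)) has_real_derivative (\<delta>\<^sup>2 - u\<^sup>2) / ?a\<^sup>2) (at u)"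
      using nz by (auto intro!: derivative_eq_intros simp: power2_eq_square algebra_simps)
    have D3: "((\<lambda>u. ln (u\<^sup>2 + \<delta>\<^sup>2)) has_real_derivative 2 * u / ?a) (at u)"
      using pos by (auto intro!: derivative_eq_intros)
    have D4: "((\<lambda>u. \<delta>\<^sup>2 / (u\<^sup>2 + \<delta>\<^sup>2)) has_real_derivative - (\<delta>\<^sup>2 * (2 * u)) / ?a\<^sup>2) (at u)"
      using nz by (auto intro!: derivative_eq_intros simp: power2_eq_square)
    have "(?F has_real_derivative A / 2 * (\<delta> / ?a / \<delta> - (\<delta>\<^sup>2 - u\<^sup>2) / ?a\<^sup>2) + c / 2 * (2 * u / ?a + - (\<delta>\<^sup>2 * (2 * u)) / ?a\<^sup>2)) (at u)"
      by (intro DERIV_add DERIV_cmult DERIV_diff DERIV_cdivide D1 D2 D3 D4)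
    moreover have "A / 2 * (\<delta> / ?a / \<delta> - (\<delta>\<^sup>2 - u\<^sup>2) / ?a\<^sup>2) + c / 2 * (2 * u / ?a + - (\<delta>\<^sup>2 * (2 * u)) / ?a\<^sup>2)
        = (A * u\<^sup>2 + c * u ^ 3) / ?a\<^sup>2"
      by (rule cubic_profile_identity[OF \<delta> refl pos])
    ultimately show "(?F has_real_derivative (A * u\<^sup>2 + c * u ^ 3) / ?a\<^sup>2) (at u)"
      by (simp only:)
    show "isCont (\<lambda>u. (A * u\<^sup>2 + c * u ^ 3) / (u\<^sup>2 + \<delta>\<^sup>2)\<^sup>2) u"
      using nz by (intro continuous_intros) auto
  qed (use \<rho> in simp)
  moreover have "?F \<rho> - ?F (- \<rho>) = A * (arctan (\<rho> / \<delta>) / \<delta> - \<rho> / (\<rho>\<^sup>2 + \<delta>\<^sup>2))"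
  proof -
    have "A * (p - q) / 2 - A * (q - p) / 2 = A * (p - q)" for p q :: real
      by (simp add: field_simps)
    then show ?thesis by (simp add: arctan_minus)
  qed
  ultimately show ?thesis by simp
qed

text \<open>Cutting the quadratic profile off at \<rho> costs O(1) uniformly in \<delta>: the defect
  pi / 2 - arctan (\<rho> / \<delta>) equals arctan (\<delta> / \<rho>) \<le> \<delta> / \<rho>, so
  division by \<delta> leaves 1 / \<rho>, and the rational term is at most another 1 /
  \<rho>.\<close>

lemma arctan_inverse_le:
  fixes \<delta> \<rho> :: real
  assumes "0 < \<delta>" "0 < \<rho>"
  shows "\<bar>(arctan (\<rho> / \<delta>) / \<delta> - \<rho> / (\<rho>\<^sup>2 + \<delta>\<^sup>2)) - pi / (2 * \<delta>)\<bar> \<le> 2 / \<rho>"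
proof -
  have eq: "pi / 2 - arctan (\<rho> / \<delta>) = arctan (\<delta> / \<rho>)"
    using arctan_inverse[of "\<rho> / \<delta>"] assms by simp
  have "arctan (\<delta> / \<rho>) \<le> \<delta> / \<rho>" "0 \<le> arctan (\<delta> / \<rho>)"
    using assms by (auto intro: arctan_le_self)
  then have "arctan (\<delta> / \<rho>) / \<delta> \<le> \<delta> / \<rho> / \<delta>" "0 \<le> arctan (\<delta> / \<rho>) / \<delta>"
    using assms by (auto intro!: divide_right_mono simp del: divide_divide_eq_left)
  then have 1: "0 \<le> arctan (\<delta> / \<rho>) / \<delta>" "arctan (\<delta> / \<rho>) / \<delta> \<le> 1 / \<rho>" using assms by auto
  have "\<rho> / (\<rho>\<^sup>2 + \<delta>\<^sup>2) \<le> \<rho> / \<rho>\<^sup>2"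
    using assms by (intro divide_left_mono) (auto simp: add_pos_pos)
  then have 2: "0 \<le> \<rho> / (\<rho>\<^sup>2 + \<delta>\<^sup>2)" "\<rho> / (\<rho>\<^sup>2 + \<delta>\<^sup>2) \<le> 1 / \<rho>"
    using assms by (auto simp: power2_eq_square)
  have "pi / (2 * \<delta>) - arctan (\<rho> / \<delta>) / \<delta> = arctan (\<delta> / \<rho>) / \<delta>"
    using assms by (simp add: eq[symmetric] field_simps)
  then show ?thesis using 1 2 by (simp add: abs_le_iff) 
qed

section \<open>Assembling the sections of a nearly parabolic region\<close>

lemma norm_pair_power4: "norm ((u, v) - (0, \<delta>)) ^ 4 = (u\<^sup>2 + (v - \<delta>)\<^sup>2)\<^sup>2" for u v \<delta> :: real
proof -
  have "norm ((u, v) - (0, \<delta>)) ^ 4 = ((norm ((u, v) - (0, \<delta>)))\<^sup>2)\<^sup>2" by simp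
  also have "(norm ((u, v) - (0, \<delta>)))\<^sup>2 = u\<^sup>2 + (v - \<delta>)\<^sup>2" by (simp add: norm_Pair)
  finally show ?thesis .
qed

text \<open>\<open>S\<close> is compared with the half-plane \<open>H\<close>, whose integral is
  exact. Their difference is bounded crudely outside the square \<open>B\<close> and integrated
  section by section inside it. \<open>far\<close> keeps the pole away from \<open>S\<close>, so
  each piece is integrable. The three summands of the error bound stem, in order, from the outside
  of the square, from the section errors and from cutting off the quadratic profile.\<close>

proposition quartic_potential_of_near_parabolic_region:
  fixes S :: "(real \<times> real) set" and \<delta> \<rho> C A c :: real
  assumes C: "1 \<le> C" and \<rho>: "0 < \<rho>" "12 * C * \<rho> \<le> 1" and \<delta>: "0 < \<delta>" "\<delta> \<le> \<rho> / 2"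
    and A: "\<bar>A\<bar> \<le> C" and c: "\<bar>c\<bar> \<le> C"
    and S: "S \<in> sets borel" and far: "S \<inter> ball (0, \<delta>) \<delta> = {}"
    and above: "\<And>u v. \<bar>u\<bar> \<le> \<rho> \<Longrightarrow> \<bar>v\<bar> \<le> \<rho> \<Longrightarrow> A * u\<^sup>2 + c * u ^ 3 + C * u ^ 4 < v \<Longrightarrow> (u, v) \<notin> S"
    and below: "\<And>u v. \<bar>u\<bar> \<le> \<rho> \<Longrightarrow> \<bar>v\<bar> \<le> \<rho> \<Longrightarrow> v < A * u\<^sup>2 + c * u ^ 3 - C * u ^ 4 \<Longrightarrow> (u, v) \<in> S"
  shows "\<bar>(\<integral>z. indicator S z * (1 / norm (z - (0, \<delta>)) ^ 4) \<partial>lborel) - (pi / (4 * \<delta>\<^sup>2) + A * pi / (2 * \<delta>))\<bar>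
     \<le> 4 * pi / \<rho>\<^sup>2 + 1000 * C ^ 3 * (2 * \<rho> + pi) + 2 * C / \<rho>"
proof -
  define \<phi> where "\<phi> z = 1 / norm (z - (0, \<delta>)) ^ 4" for z :: "real \<times> real"
  define H where "H = {z :: real \<times> real. snd z \<le> 0}"
  define B where "B = {z :: real \<times> real. \<bar>fst z\<bar> \<le> \<rho> \<and> \<bar>snd z\<bar> \<le> \<rho>}"
  define h where "h z = indicator B z * (indicator S z - indicator H z) * \<phi> z" for z
  define t where "t z = indicator (- B) z * (indicator S z - indicator H z) * \<phi> z" for z
  have \<phi>0: "0 \<le> \<phi> z" for z by (simp add: \<phi>_def)
  have \<phi>_pair: "\<phi> (u, v) = 1 / (u\<^sup>2 + (v - \<delta>)\<^sup>2)\<^sup>2" for u v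
    by (simp only: \<phi>_def norm_pair_power4)
  have [measurable]: "\<phi> \<in> borel_measurable borel" unfolding \<phi>_def by measurable
  have "closed H" "closed B" unfolding H_def B_def
    by (intro closed_Collect_conj closed_Collect_le continuous_intros)+
  then have [measurable]: "H \<in> sets borel" "B \<in> sets borel" by auto
  note S[measurable]
  have outside: "has_bochner_integral lborel (\<lambda>z::real\<times>real. indicator (- ball (0, \<delta>) \<epsilon>) z * \<phi> z) (pi / \<epsilon>\<^sup>2)" if "0 < \<epsilon>" for \<epsilon>
    unfolding \<phi>_def using that by (intro has_integral_inverse_fourth_power_outside_ball) auto
  have int_if: "integrable lborel (\<lambda>z. indicator X z * \<phi> z)"
    if [measurable]: "X \<in> sets borel" and X: "X \<inter> ball (0, \<delta>) \<delta> = {}" for X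
  proof (rule Bochner_Integration.integrable_bound)
    show "integrable lborel (\<lambda>z::real\<times>real. indicator (- ball (0, \<delta>) \<delta>) z * \<phi> z)"
      using outside[OF \<delta>(1)] by (simp add: has_bochner_integral_iff)
    show "AE z in lborel. norm (indicator X z * \<phi> z) \<le> norm (indicator (- ball (0, \<delta>) \<delta>) z * \<phi> z)"
      using X \<phi>0 by (intro AE_I2) (auto simp: indicator_def)
  qed measurable
  have Hfar: "H \<inter> ball (0, \<delta>) \<delta> = {}"
  proof -
    have "\<delta> \<le> dist (0, \<delta>) z" if "snd z \<le> 0" for z :: "real \<times> real"
    proof -
      have "\<delta> \<le> dist \<delta> (snd z)" using that \<delta> by (simp add: dist_real_def)
      also have "\<dots> \<le> dist (0, \<delta>) z" using dist_snd_le[of "(0, \<delta>)" z] by simp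
      finally show ?thesis .
    qed
    then show ?thesis unfolding H_def disjoint_iff mem_Collect_eq mem_ball by (meson not_le)
  qed
  have intS: "integrable lborel (\<lambda>z. indicator S z * \<phi> z)" by (rule int_if[OF S far])
  have intH: "integrable lborel (\<lambda>z. indicator H z * \<phi> z)" by (rule int_if[OF _ Hfar]) measurable
  have valH: "(\<integral>z. indicator H z * \<phi> z \<partial>lborel) = pi / (4 * \<delta>\<^sup>2)"
  proof -
    have "(\<integral>\<^sup>+z. ennreal (indicator H z * \<phi> z) \<partial>lborel)
       = (\<integral>\<^sup>+(u, v). ennreal (1 / (u\<^sup>2 + (v - \<delta>)\<^sup>2)\<^sup>2) * indicator {..0} v \<partial>lborel)"
      by (intro nn_integral_cong) (auto simp: H_def \<phi>_pair indicator_def)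
    then have "(\<integral>\<^sup>+z. ennreal (indicator H z * \<phi> z) \<partial>lborel) = ennreal (pi / (4 * \<delta>\<^sup>2))"
      using nn_integral_quartic_kernel_half_plane[OF \<delta>(1)] by simp
    then show ?thesis
      by (subst integral_eq_nn_integral) (auto simp: \<phi>0)
  qed
  have dec: "indicator S z * \<phi> z - indicator H z * \<phi> z = h z + t z" for z
    by (auto simp: h_def t_def indicator_def algebra_simps)
  \<comment> \<open>The pole has height \<delta> \<le> \<rho> / 2, so the complement of the square
    keeps the distance \<rho> / 2 from it; the exact value outside a disc then bounds the
    tail.\<close>
  have t_bound: "\<bar>t z\<bar> \<le> indicator (- ball (0, \<delta>) (\<rho> / 2)) z * \<phi> z" for z
  proof (cases "z \<in> B")
    case False
    have "\<rho> / 2 \<le> dist (0, \<delta>) z"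
    proof (cases "\<bar>fst z\<bar> \<le> \<rho>")
      case True
      then have "\<rho> < \<bar>snd z\<bar>" using False by (auto simp: B_def)
      then have "\<rho> / 2 \<le> dist \<delta> (snd z)" using \<delta> unfolding dist_real_def by linarith
      also have "\<dots> \<le> dist (0, \<delta>) z" using dist_snd_le[of "(0, \<delta>)" z] by simp
      finally show ?thesis .
    next
      case False
      then have "\<rho> / 2 \<le> dist 0 (fst z)" using \<rho> by (simp add: dist_real_def)
      also have "\<dots> \<le> dist (0, \<delta>) z" using dist_fst_le[of "(0, \<delta>)" z] by simp
      finally show ?thesis .
    qed
    then show ?thesis using \<phi>0 by (auto simp: t_def indicator_def)
  qed (use \<phi>0 in \<open>simp add: t_def\<close>)
  have out2: "has_bochner_integral lborel (\<lambda>z::real\<times>real. indicator (- ball (0, \<delta>) (\<rho> / 2)) z * \<phi> z) (4 * pi / \<rho>\<^sup>2)"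
    using outside[of "\<rho> / 2"] \<rho> by (simp add: power_divide mult.commute)
  have int_t: "integrable lborel t"
  proof (rule Bochner_Integration.integrable_bound)
    show "integrable lborel (\<lambda>z::real\<times>real. indicator (- ball (0, \<delta>) (\<rho> / 2)) z * \<phi> z)"
      using out2 by (simp add: has_bochner_integral_iff)
    show "t \<in> borel_measurable lborel" unfolding t_def by measurable
    show "AE z in lborel. norm (t z) \<le> norm (indicator (- ball (0, \<delta>) (\<rho> / 2)) z * \<phi> z)"
      using t_bound \<phi>0 by (intro AE_I2) (simp add: abs_mult)
  qed
  have val_t: "\<bar>\<integral>z. t z \<partial>lborel\<bar> \<le> 4 * pi / \<rho>\<^sup>2"
  proof -
    have "norm (\<integral>z. t z \<partial>lborel) \<le> (\<integral>z. indicator (- ball (0, \<delta>) (\<rho> / 2)) z * \<phi> z \<partial>lborel)"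
      using int_t out2 t_bound by (intro Bochner_Integration.integral_norm_bound_integral) (auto simp: has_bochner_integral_iff)
    then show ?thesis using out2 by (simp add: has_bochner_integral_iff)
  qed
  have int_h: "integrable lborel h"
  proof -
    have "integrable lborel (\<lambda>z. indicator S z * \<phi> z - indicator H z * \<phi> z - t z)"
      using intS intH int_t by (intro Bochner_Integration.integrable_diff)
    then show ?thesis by (simp add: dec)
  qed
  have total: "(\<integral>z. indicator S z * \<phi> z \<partial>lborel) - pi / (4 * \<delta>\<^sup>2) = (\<integral>z. h z \<partial>lborel) + (\<integral>z. t z \<partial>lborel)"
  proof -
    have "(\<integral>z. indicator S z * \<phi> z \<partial>lborel) - (\<integral>z. indicator H z * \<phi> z \<partial>lborel) = (\<integral>z. h z + t z \<partial>lborel)"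
      unfolding Bochner_Integration.integral_diff[OF intS intH, symmetric] dec ..
    then show ?thesis using int_h int_t valH by simp
  qed
  define I where "I u = (\<integral>v. h (u, v) \<partial>lborel)" for u
  have int_h': "integrable (lborel \<Otimes>\<^sub>M lborel) h" using int_h by (simp add: lborel_prod)
  have I: "integrable lborel I" "(\<integral>u. I u \<partial>lborel) = (\<integral>z. h z \<partial>lborel)"
    using lborel_pair.integrable_fst'[OF int_h'] lborel_pair.integral_fst'[OF int_h']
    unfolding I_def[abs_def] by (simp_all add: lborel_prod)
  define G where "G u = (A * u\<^sup>2 + c * u ^ 3) / (u\<^sup>2 + \<delta>\<^sup>2)\<^sup>2 * indicator {- \<rho>..\<rho>} u" for u
  have G: "has_bochner_integral lborel G (A * (arctan (\<rho> / \<delta>) / \<delta> - \<rho> / (\<rho>\<^sup>2 + \<delta>\<^sup>2)))"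
    unfolding G_def by (rule integral_cubic_profile[OF \<delta>(1) \<rho>(1)])
  \<comment> \<open>Majorant of the section errors. Apart from the constant factor, its second
    summand integrates to 2 arctan (\<rho> / \<delta>) < pi, for every \<delta>.\<close>
  define E where "E u = 1000 * C ^ 3 * (indicator {- \<rho>..\<rho>} u + \<delta> / (u\<^sup>2 + \<delta>\<^sup>2) * indicator {- \<rho>..\<rho>} u)" for u
  have pos: "u\<^sup>2 + \<delta>\<^sup>2 > 0" for u using \<delta> by (simp add: add_nonneg_pos)
  then have nz: "u\<^sup>2 + \<delta>\<^sup>2 \<noteq> 0" for u by (metis less_irrefl)
  have E: "has_bochner_integral lborel E (1000 * C ^ 3 * (2 * \<rho> + (arctan (\<rho> / \<delta>) - arctan (- \<rho> / \<delta>))))"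
  proof -
    have "has_bochner_integral lborel (\<lambda>u. \<delta> / (u\<^sup>2 + \<delta>\<^sup>2) * indicator {- \<rho>..\<rho>} u) (arctan (\<rho> / \<delta>) - arctan (- \<rho> / \<delta>))"
    proof (rule has_bochner_integral_FTC_Icc_real)
      fix u
      show "((\<lambda>u. arctan (u / \<delta>)) has_real_derivative \<delta> / (u\<^sup>2 + \<delta>\<^sup>2)) (at u)"
        using \<delta>(1) by (rule has_real_derivative_arctan_divide)
      show "isCont (\<lambda>u. \<delta> / (u\<^sup>2 + \<delta>\<^sup>2)) u" using nz by (intro continuous_intros) auto
    qed (use \<rho> in simp)
    moreover have "has_bochner_integral lborel (indicator {- \<rho>..\<rho>} :: real \<Rightarrow> real) (2 * \<rho>)"
      using has_bochner_integral_real_indicator[of "{- \<rho>..\<rho>}" lborel] \<rho> by simp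
    ultimately show ?thesis unfolding E_def
      by (intro has_bochner_integral_add has_bochner_integral_mult_right)
  qed
  have IG: "norm (I u - G u) \<le> E u" for u
  proof (cases "\<bar>u\<bar> \<le> \<rho>")
    case True
    have [measurable]: "{v. (u, v) \<in> S} \<in> sets borel"
    proof -
      have "(\<lambda>v. (u, v)) -` S \<inter> space borel \<in> sets borel"
        by (rule measurable_sets[OF _ S]) (intro borel_measurable_continuous_onI continuous_intros)
      then show ?thesis by (simp add: vimage_def)
    qed
    have "h (u, v) = indicator {- \<rho>..\<rho>} v * (indicator {v. (u, v) \<in> S} v - indicator {..0} v) * (1 / (u\<^sup>2 + (v - \<delta>)\<^sup>2)\<^sup>2)" for v
      using True by (auto simp: h_def \<phi>_pair B_def H_def indicator_def)
    then have "\<bar>I u - (A * u\<^sup>2 + c * u ^ 3) / (u\<^sup>2 + \<delta>\<^sup>2)\<^sup>2\<bar> \<le> 1000 * C ^ 3 * (1 + \<delta> / (u\<^sup>2 + \<delta>\<^sup>2))"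
      unfolding I_def
      using graph_section_estimate[OF C \<rho>(2) True \<delta>(1) A c, of "{v. (u, v) \<in> S}"] above[OF True] below[OF True]
      by simp
    then show ?thesis using True by (auto simp: G_def E_def indicator_def)
  next
    case False
    then have "h (u, v) = 0" for v by (simp add: h_def B_def)
    then have "I u = 0" by (simp add: I_def)
    moreover have "u \<notin> {- \<rho>..\<rho>}" using False by auto
    ultimately show ?thesis by (simp add: G_def E_def)
  qed
  have "norm (\<integral>u. I u - G u \<partial>lborel) \<le> (\<integral>u. E u \<partial>lborel)"
    using I G E IG by (intro Bochner_Integration.integral_norm_bound_integral) (auto simp: has_bochner_integral_iff)
  moreover have "(\<integral>u. I u - G u \<partial>lborel) = (\<integral>z. h z \<partial>lborel) - A * (arctan (\<rho> / \<delta>) / \<delta> - \<rho> / (\<rho>\<^sup>2 + \<delta>\<^sup>2))"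
    using I G by (simp add: has_bochner_integral_iff)
  moreover have "(\<integral>u. E u \<partial>lborel) \<le> 1000 * C ^ 3 * (2 * \<rho> + pi)"
  proof -
    have "arctan (\<rho> / \<delta>) - arctan (- \<rho> / \<delta>) \<le> pi"
      using arctan_ubound[of "\<rho> / \<delta>"] by (simp add: arctan_minus)
    then show ?thesis using E C by (simp add: has_bochner_integral_iff)
  qed
  ultimately have 1: "\<bar>(\<integral>z. h z \<partial>lborel) - A * (arctan (\<rho> / \<delta>) / \<delta> - \<rho> / (\<rho>\<^sup>2 + \<delta>\<^sup>2))\<bar> \<le> 1000 * C ^ 3 * (2 * \<rho> + pi)"
    by simp
  have 2: "\<bar>A * (arctan (\<rho> / \<delta>) / \<delta> - \<rho> / (\<rho>\<^sup>2 + \<delta>\<^sup>2)) - A * pi / (2 * \<delta>)\<bar> \<le> 2 * C / \<rho>"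
  proof -
    have "\<bar>A\<bar> * \<bar>(arctan (\<rho> / \<delta>) / \<delta> - \<rho> / (\<rho>\<^sup>2 + \<delta>\<^sup>2)) - pi / (2 * \<delta>)\<bar> \<le> C * (2 / \<rho>)"
      using arctan_inverse_le[OF \<delta>(1) \<rho>(1)] A C by (intro mult_mono) auto
    then show ?thesis by (simp add: abs_mult[symmetric] right_diff_distrib mult.commute)
  qed
  show ?thesis using total val_t 1 2 unfolding \<phi>_def[symmetric] by linarith
qed

section \<open>Orthonormal frames of the plane\<close>

lemma inner_real2: "x \<bullet> y = x $ 1 * y $ 1 + x $ 2 * y $ 2" for x y :: "real^2"
  by (simp add: inner_vec_def sum_2)

lemma rot90_nth [simp]: "rot90 v $ 1 = - (v $ 2)" "rot90 v $ 2 = v $ 1"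
  by (simp_all add: rot90_def)

lemma inner_rot90 [simp]: "v \<bullet> rot90 v = 0" "rot90 v \<bullet> v = 0" "rot90 v \<bullet> rot90 w = v \<bullet> w"
  by (simp_all add: inner_real2)

text \<open>The coordinates form a pair, so that Fubini applies directly. \<open>frame 0 e\<close>
  inverts the coordinates of a chart, while \<open>frame q \<tau>\<close> is used with the unit
  tangent \<tau> at \<open>q\<close>.\<close>

definition frame :: "real^2 \<Rightarrow> real^2 \<Rightarrow> real \<times> real \<Rightarrow> real^2" where
  "frame q \<tau> p = q + (fst p *\<^sub>R \<tau> + snd p *\<^sub>R rot90 \<tau>)"

lemma frame_expand:
  assumes "norm e = 1"
  shows "z = frame q e (e \<bullet> (z - q), rot90 e \<bullet> (z - q))"
proof -
  have e: "e $ 1 * e $ 1 + e $ 2 * e $ 2 = 1"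
    using assms by (simp add: norm_eq_1 inner_real2)
  define a where "a = z - q"
  have "a $ 1 = (e $ 1 * e $ 1 + e $ 2 * e $ 2) * a $ 1" "a $ 2 = (e $ 1 * e $ 1 + e $ 2 * e $ 2) * a $ 2"
    by (simp_all add: e)
  then have "a = (e \<bullet> a) *\<^sub>R e + (rot90 e \<bullet> a) *\<^sub>R rot90 e"
    by (simp add: vec_eq_iff forall_2 inner_real2 algebra_simps)
  then show ?thesis by (simp add: frame_def a_def)
qed

lemma dist_frame:
  assumes "norm \<tau> = 1"
  shows "norm (frame q \<tau> x - frame q \<tau> y) = norm (x - y)"
proof -
  have \<tau>: "\<tau> \<bullet> \<tau> = 1" using assms by (simp add: norm_eq_1)
  have "frame q \<tau> x - frame q \<tau> y = (fst x - fst y) *\<^sub>R \<tau> + (snd x - snd y) *\<^sub>R rot90 \<tau>"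
    by (simp add: frame_def algebra_simps)
  then show ?thesis
    by (simp add: norm_eq_sqrt_inner inner_prod_def inner_left_distrib inner_right_distrib \<tau>)
qed

section \<open>Frames preserve Lebesgue measure\<close>

lemma continuous_frame: "continuous_on UNIV (frame q \<tau>)"
  unfolding frame_def by (intro continuous_intros)

text \<open>The preimage of a box is open and bounded, hence of finite measure, and invariance of
  finite measures under orthogonal maps applies to it. Boxes are enough because they determine
  \<open>lborel\<close>.\<close>

lemma emeasure_lborel_orthogonal_vimage_box:
  fixes R :: "real^'n::{finite,wellorder} \<Rightarrow> real^'n::_"
  assumes "orthogonal_transformation R"
  shows "emeasure lborel (R -` box l u) = emeasure lborel (box l u)"
proof -
  have lin: "linear R" and "bij R" and norm: "\<And>x. norm (R x) = norm x"
    using assms by (auto simp: orthogonal_transformation orthogonal_transformation_bij)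
  then have im: "R ` (R -` box l u) = box l u" by (simp add: bij_is_surj surj_image_vimage_eq)
  have "bounded (R -` box l u)"
    using bounded_box[of l u] unfolding bounded_iff by (metis norm vimageE)
  moreover have op: "open (R -` box l u)"
    using lin by (intro open_vimage linear_continuous_on) (auto simp: linear_conv_bounded_linear)
  ultimately have lm: "R -` box l u \<in> lmeasurable" by (rule lmeasurable_open)
  have "measure lebesgue (box l u) = measure lebesgue (R -` box l u)"
    using measure_orthogonal_image[OF assms lm] im by simp
  then have "emeasure lebesgue (R -` box l u) = emeasure lebesgue (box l u)"
    by (simp only: emeasure_eq_measure2[OF lm] emeasure_eq_measure2[OF lmeasurable_box])
  then show ?thesis using op by simp
qed

lemma frame_axis_nth [simp]: "frame 0 (axis 1 1) p $ 1 = fst p" "frame 0 (axis 1 1) p $ 2 = snd p"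
  by (simp_all add: frame_def axis_def)

lemma measurable_frame [measurable]: "frame q \<tau> \<in> borel_measurable borel"
  by (rule borel_measurable_continuous_onI[OF continuous_frame])

text \<open>With the standard basis as frame, the map is the plain identification of
  \<open>real \<times> real\<close> with \<open>real^2\<close>; it carries the product measure
  over.\<close>

lemma distr_lborel_frame_axis: "distr lborel borel (frame 0 (axis 1 1)) = lborel"
proof (rule lborel_eqI[symmetric])
  fix l u :: "real^2"
  assume le: "\<And>b. b \<in> Basis \<Longrightarrow> l \<bullet> b \<le> u \<bullet> b"
  have le': "l $ 1 \<le> u $ 1" "l $ 2 \<le> u $ 2"
    using le[of "axis 1 1"] le[of "axis 2 1"] by (auto simp: Basis_vec_def inner_axis)
  have "emeasure (distr lborel borel (frame 0 (axis 1 1))) (box l u)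
     = emeasure lborel (frame 0 (axis 1 1) -` box l u)"
    by (simp add: emeasure_distr)
  also have "frame 0 (axis 1 1) -` box l u = {l $ 1<..<u $ 1} \<times> {l $ 2<..<u $ 2}"
    by (auto simp: mem_box_cart forall_2)
  also have "emeasure lborel \<dots> = ennreal ((u $ 1 - l $ 1) * (u $ 2 - l $ 2))"
    using le' by (simp flip: lborel_prod add: lborel.emeasure_pair_measure_Times ennreal_mult')
  also have "(u $ 1 - l $ 1) * (u $ 2 - l $ 2) = (\<Prod>b\<in>Basis. (u - l) \<bullet> b)"
  proof -
    have "(\<Prod>b\<in>Basis. (u - l) \<bullet> b) = (\<Prod>i\<in>UNIV. (u - l) $ i)"
      by (simp add: Basis_vec_def prod.UNION_disjoint inner_axis UNION_singleton_eq_range prod.reindex inj_on_def axis_eq_axis)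
    then show ?thesis by (simp add: prod_2 UNIV_2)
  qed
  finally show "emeasure (distr lborel borel (frame 0 (axis 1 1))) (box l u) = ennreal (\<Prod>b\<in>Basis. (u - l) \<bullet> b)" .
qed simp

lemma distr_lborel_frame:
  assumes "norm \<tau> = 1"
  shows "distr lborel borel (frame q \<tau>) = lborel"
proof -
  define R where "R x = (x $ 1) *\<^sub>R \<tau> + (x $ 2) *\<^sub>R rot90 \<tau>" for x :: "real^2"
  have \<tau>: "\<tau> \<bullet> \<tau> = 1" using assms by (simp add: norm_eq_1)
  have lin: "linear R"
    by (rule linearI) (simp_all add: R_def algebra_simps)
  have "R x \<bullet> R y = x \<bullet> y" for x y
    by (simp add: R_def inner_left_distrib inner_right_distrib \<tau> inner_real2[of x y])
  then have orth: "orthogonal_transformation R"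
    using lin by (simp add: orthogonal_transformation_def)
  have contR: "continuous_on UNIV R" using lin by (intro linear_continuous_on) (auto simp: linear_conv_bounded_linear)
  then have [measurable]: "R \<in> borel_measurable borel" by (rule borel_measurable_continuous_onI)
  have "distr lborel borel R = lborel"
  proof (rule lborel_eqI[symmetric])
    fix l u :: "real^2"
    assume le: "\<And>b. b \<in> Basis \<Longrightarrow> l \<bullet> b \<le> u \<bullet> b"
    have "emeasure (distr lborel borel R) (box l u) = emeasure lborel (R -` box l u)"
      by (simp add: emeasure_distr)
    also have "\<dots> = emeasure lborel (box l u)"
      by (rule emeasure_lborel_orthogonal_vimage_box[OF orth])
    also have "\<dots> = ennreal (\<Prod>b\<in>Basis. (u - l) \<bullet> b)"
      by (rule emeasure_lborel_box[OF le])
    finally show "emeasure (distr lborel borel R) (box l u) = ennreal (\<Prod>b\<in>Basis. (u - l) \<bullet> b)" .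
  qed simp
  moreover have "distr lborel borel ((+) q) = lborel" by (rule lborel_distr_plus)
  \<comment> \<open>A frame is the identification of pairs with vectors, followed by the rotation
    \<open>R\<close> and a translation, each of which preserves \<open>lborel\<close>.\<close>
  moreover have "frame q \<tau> = (+) q \<circ> (R \<circ> frame 0 (axis 1 1))"
    by (auto simp: frame_def[of q] R_def)
  then have "distr lborel borel (frame q \<tau>) = distr (distr (distr lborel borel (frame 0 (axis 1 1))) borel R) borel ((+) q)"
    by (simp add: distr_distr)
  ultimately show ?thesis
    by (simp add: distr_lborel_frame_axis)
qed

section \<open>Graphs in their tangent frames\<close>

lemma C_infinity_has_vector_derivative:
  assumes "C_infinity f"
  shows "(((\<lambda>g s. vector_derivative g (at s)) ^^ k) f has_vector_derivative ((\<lambda>g s. vector_derivative g (at s)) ^^ Suc k) f t) (at t)"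
  using assms unfolding C_infinity_def by (auto simp: vector_derivative_works)

lemma C_infinity_continuous:
  assumes "C_infinity f"
  shows "continuous_on S (((\<lambda>g s. vector_derivative g (at s)) ^^ k) f)"
  using C_infinity_has_vector_derivative[OF assms, of k]
  by (meson continuous_at_imp_continuous_on has_vector_derivative_continuous)

text \<open>Lagrange's form of the remainder, with 1 / 24 absorbed into \<open>M\<close>. The bound
  involves \<open>M\<close> on an interval only, which makes it uniform in the centre
  \<open>x\<close>.\<close>

lemma C_infinity_Taylor3:
  fixes f :: "real \<Rightarrow> real"
  assumes f: "C_infinity f" and D: "D = (\<lambda>k. ((\<lambda>g s. vector_derivative g (at s)) ^^ k) f)"
    and ab: "a \<le> x" "x \<le> b" "a \<le> y" "y \<le> b"
    and M: "\<And>z. a \<le> z \<Longrightarrow> z \<le> b \<Longrightarrow> \<bar>D 4 z\<bar> \<le> M"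
  shows "\<bar>f y - (f x + D 1 x * (y - x) + D 2 x / 2 * (y - x)\<^sup>2 + D 3 x / 6 * (y - x) ^ 3)\<bar> \<le> M * (y - x) ^ 4"
proof -
  have der: "DERIV (D m) t :> D (Suc m) t" for m t
    unfolding D has_real_derivative_iff_has_vector_derivative by (rule C_infinity_has_vector_derivative[OF f])
  have D0: "D 0 = f" by (simp add: D)
  have "0 \<le> M" using M[of x] ab by linarith
  show ?thesis
  proof (cases "y = x")
    case False
    obtain t where t: "a \<le> t" "t \<le> b" and eq: "f y = (\<Sum>m<4. (D m x / fact m) * (y - x) ^ m) + D 4 t / fact 4 * (y - x) ^ 4"
    proof -
      have "\<exists>t. (if y < x then y < t \<and> t < x else x < t \<and> t < y) \<and>
        f y = (\<Sum>m<4. (D m x / fact m) * (y - x) ^ m) + D 4 t / fact 4 * (y - x) ^ 4"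
        using ab False by (intro Taylor[where a = a and b = b]) (auto simp: D0 der)
      then show ?thesis using ab that by (smt (verit))
    qed
    have rem: "f y - (f x + D 1 x * (y - x) + D 2 x / 2 * (y - x)\<^sup>2 + D 3 x / 6 * (y - x) ^ 3) = D 4 t / 24 * (y - x) ^ 4"
      by (simp add: eq eval_nat_numeral D0 fact_numeral)
    have "\<bar>D 4 t / 24\<bar> \<le> M" using M[OF t] by simp
    then have "\<bar>D 4 t / 24\<bar> * \<bar>(y - x) ^ 4\<bar> \<le> M * \<bar>(y - x) ^ 4\<bar>" by (intro mult_right_mono) auto
    then show ?thesis unfolding rem abs_mult by simp
  qed simp
qed

text \<open>
  A point has coordinates \<open>(u, v)\<close> in the tangent frame at a point of the graph of \<open>f\<close>, and \<open>t\<close> is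
  its horizontal displacement from that point. The numbers \<open>f1\<close>, \<open>f2\<close>, \<open>f3\<close> are the derivatives of
  \<open>f\<close> there, \<open>R\<close> is the Taylor remainder, and \<open>\<Phi>\<close> is the height of the point above the graph.
  Solving \<open>\<Phi> = 0\<close> for \<open>v\<close> up to order \<open>u\<^sup>3\<close> yields \<open>A\<close> (half the curvature) and \<open>c\<close>.
  The constant \<open>C\<close> is not optimized.
\<close>

lemma graph_in_tangent_frame:
  fixes M f1 f2 f3 L A B c C \<rho> u v t R \<Phi> :: real
  defines "L \<equiv> sqrt (1 + f1\<^sup>2)"
  defines "A \<equiv> f2 / (2 * L ^ 3)" and "B \<equiv> f3 / (6 * L ^ 4)"
  defines "c \<equiv> B - 2 * A\<^sup>2 * f1" and "C \<equiv> 884 * M ^ 10"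
  defines "t \<equiv> (u - f1 * v) / L"
  defines "\<Phi> \<equiv> (f1 * u + v) / L - (f1 * t + f2 / 2 * t\<^sup>2 + f3 / 6 * t ^ 3 + R)"
  assumes M: "1 \<le> M" "\<bar>f1\<bar> \<le> M" "\<bar>f2\<bar> \<le> M" "\<bar>f3\<bar> \<le> M"
    and \<rho>: "12 * C * \<rho> \<le> 1" and u: "\<bar>u\<bar> \<le> \<rho>" and v: "\<bar>v\<bar> \<le> \<rho>" and R: "\<bar>R\<bar> \<le> M * t ^ 4"
  shows "\<bar>A\<bar> \<le> C" "\<bar>c\<bar> \<le> C"
    and "A * u\<^sup>2 + c * u ^ 3 + C * u ^ 4 < v \<Longrightarrow> 0 < \<Phi>"
    and "v < A * u\<^sup>2 + c * u ^ 3 - C * u ^ 4 \<Longrightarrow> \<Phi> < 0"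
proof -
  have Mpow: "M ^ i \<le> M ^ j" if "i \<le> j" for i j using M that by (intro power_increasing) auto
  have M1: "1 \<le> M ^ i" for i using M by (simp add: one_le_power)
  have L: "1 \<le> L" "L\<^sup>2 = 1 + f1\<^sup>2" "\<bar>f1\<bar> \<le> L"
    by (auto simp: L_def real_le_rsqrt)
  then have L0: "0 < L" by simp
  have Lpow: "1 \<le> L ^ i" for i using L by (simp add: one_le_power)
  have A: "\<bar>A\<bar> \<le> M"
  proof -
    have "\<bar>A\<bar> = \<bar>f2\<bar> / (2 * L ^ 3)" using L0 by (simp add: A_def abs_mult)
    also have "\<dots> \<le> \<bar>f2\<bar> / 1" using Lpow[of 3] L0 by (intro divide_left_mono) auto
    finally show ?thesis using M by simp
  qed
  have B: "\<bar>B\<bar> \<le> M"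
  proof -
    have "\<bar>B\<bar> = \<bar>f3\<bar> / (6 * L ^ 4)" using L0 by (simp add: B_def abs_mult)
    also have "\<dots> \<le> \<bar>f3\<bar> / 1" using Lpow[of 4] L0 by (intro divide_left_mono) auto
    finally show ?thesis using M by simp
  qed
  have c: "\<bar>c\<bar> \<le> 3 * M ^ 3"
  proof -
    have "\<bar>A\<bar>\<^sup>2 * \<bar>f1\<bar> \<le> M\<^sup>2 * M" using A M by (intro mult_mono power_mono) auto
    then have "\<bar>2 * A\<^sup>2 * f1\<bar> \<le> 2 * M ^ 3" by (simp add: abs_mult power2_eq_square power3_eq_cube)
    moreover have "\<bar>B\<bar> \<le> M ^ 3" using B Mpow[of 1 3] by simp
    ultimately show ?thesis unfolding c_def by linarith
  qed
  show "\<bar>A\<bar> \<le> C" "\<bar>c\<bar> \<le> C"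
    using A c Mpow[of 1 10] Mpow[of 3 10] M1[of 10] by (simp_all add: C_def)
  have C1: "1 \<le> C" using M1[of 10] by (simp add: C_def)
  have \<rho>0: "0 \<le> \<rho>" using u by linarith
  have \<rho>1: "\<rho> \<le> 1"
  proof -
    have "1 * \<rho> \<le> 12 * C * \<rho>" using C1 \<rho>0 by (intro mult_right_mono) auto
    then show ?thesis using \<rho> by linarith
  qed
  define g where "g = A * u\<^sup>2 + c * u ^ 3"
  define d where "d = v - g"
  \<comment> \<open>What remains of \<Phi> / L once \<open>d\<close>, the height above the cubic
    approximation, is split off. The aim is \<bar>X\<bar> < \<bar>d\<bar> whenever \<bar>d\<bar> > C
    u^4, so that \<Phi> has the sign of \<open>d\<close>.\<close>
  define X where "X = 2 * A * f1 * u * (d + c * u ^ 3) - A * f1\<^sup>2 * v\<^sup>2 - B * ((u - f1 * v) ^ 3 - u ^ 3) - R / L"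
  have key: "\<Phi> / L = d + X"
  proof -
    have "(f1 * u + v) / L - f1 * t = v * (1 + f1\<^sup>2) / L"
      by (simp add: t_def diff_divide_distrib[symmetric] power2_eq_square algebra_simps)
    also have "\<dots> = v * L\<^sup>2 / L" by (simp only: L(2))
    also have "\<dots> = L * v" using L0 by (simp add: power2_eq_square)
    finally have "\<Phi> = L * v - f2 / 2 * t\<^sup>2 - f3 / 6 * t ^ 3 - R" by (simp add: \<Phi>_def)
    then have "\<Phi> / L = L * v / L - f2 / 2 * t\<^sup>2 / L - f3 / 6 * t ^ 3 / L - R / L" by (simp add: diff_divide_distrib)
    moreover have "L * v / L = v" using L0 by simp
    moreover have "f2 / 2 * t\<^sup>2 / L = A * (u - f1 * v)\<^sup>2"
      using L0 by (simp add: t_def A_def power_divide eval_nat_numeral)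
    moreover have "f3 / 6 * t ^ 3 / L = B * (u - f1 * v) ^ 3"
      using L0 by (simp add: t_def B_def power_divide eval_nat_numeral)
    ultimately have 1: "\<Phi> / L = v - A * (u - f1 * v)\<^sup>2 - B * (u - f1 * v) ^ 3 - R / L" by simp
    have v: "v = d + g" by (simp add: d_def)
    have "A * (u - f1 * v)\<^sup>2 = A * u\<^sup>2 - 2 * A * f1 * u * (d + g) + A * f1\<^sup>2 * v\<^sup>2"
      unfolding v by (simp add: power2_eq_square algebra_simps)
    \<comment> \<open>Inserting the leading part A u^2 of v into the cross term creates 2 A^2 f1
      u^3; the correction in \<open>c\<close> is there to cancel it.\<close>
    also have "2 * A * f1 * u * (d + g) = 2 * A * f1 * u * (d + c * u ^ 3) + 2 * A\<^sup>2 * f1 * u ^ 3"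
      unfolding g_def by (simp add: power2_eq_square power3_eq_cube algebra_simps)
    finally have 2: "A * (u - f1 * v)\<^sup>2 = A * u\<^sup>2 - 2 * A * f1 * u * (d + c * u ^ 3) - 2 * A\<^sup>2 * f1 * u ^ 3 + A * f1\<^sup>2 * v\<^sup>2"
      by simp
    have 3: "B * u ^ 3 = c * u ^ 3 + 2 * A\<^sup>2 * f1 * u ^ 3" unfolding c_def by (simp add: algebra_simps)
    have 4: "v = d + A * u\<^sup>2 + c * u ^ 3" by (simp add: d_def g_def)
    have 5: "B * ((u - f1 * v) ^ 3 - u ^ 3) = B * (u - f1 * v) ^ 3 - B * u ^ 3" by (simp add: algebra_simps)
    show ?thesis unfolding 1 X_def 5 using 2 3 4 by linarith
  qed
  have u1: "\<bar>u\<bar> \<le> 1" and v1: "\<bar>v\<bar> \<le> 1" using u v \<rho>1 by auto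
  have u3: "\<bar>u\<bar> ^ 3 \<le> u\<^sup>2" using power_decreasing[of 2 3 "\<bar>u\<bar>"] u1 by simp
  have uu: "u\<^sup>2 \<le> \<rho>"
  proof -
    have "\<bar>u\<bar> * \<bar>u\<bar> \<le> \<rho> * 1" using u u1 \<rho>0 by (intro mult_mono) auto
    then show ?thesis by (simp add: power2_eq_square)
  qed
  have g: "\<bar>g\<bar> \<le> 4 * M ^ 3 * u\<^sup>2"
  proof -
    have "\<bar>A * u\<^sup>2\<bar> \<le> M ^ 3 * u\<^sup>2"
      using A Mpow[of 1 3] by (auto simp: abs_mult intro!: mult_right_mono)
    moreover have "\<bar>c * u ^ 3\<bar> \<le> 3 * M ^ 3 * u\<^sup>2"
    proof -
      have "\<bar>c\<bar> * \<bar>u\<bar> ^ 3 \<le> 3 * M ^ 3 * u\<^sup>2" using c u3 M by (intro mult_mono) auto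
      then show ?thesis by (simp add: abs_mult power_abs)
    qed
    ultimately show ?thesis unfolding g_def by linarith
  qed
  define W where "W = \<rho> * \<bar>d\<bar>"
  define U where "U = u ^ 4"
  have W0: "0 \<le> W" "0 \<le> U" using \<rho>0 by (auto simp: W_def U_def)
  \<comment> \<open>With this a priori bound a square of \<open>d\<close> becomes a multiple of
    \<open>W\<close>.\<close>
  have d: "\<bar>d\<bar> \<le> 5 * M ^ 3 * \<rho>"
  proof -
    have "4 * M ^ 3 * u\<^sup>2 \<le> 4 * M ^ 3 * \<rho>" using uu M by (intro mult_left_mono) auto
    moreover have "1 * \<rho> \<le> M ^ 3 * \<rho>" using M1[of 3] \<rho>0 by (intro mult_right_mono) auto
    ultimately show ?thesis using g v unfolding d_def by linarith
  qed
  have v2: "v\<^sup>2 \<le> 10 * M ^ 3 * W + 32 * M ^ 6 * U"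
  proof -
    have "v\<^sup>2 = (d + g)\<^sup>2" by (simp add: d_def)
    also have "\<dots> \<le> 2 * d\<^sup>2 + 2 * g\<^sup>2"
      using zero_le_power2[of "d - g"] by (simp add: power2_eq_square algebra_simps)
    also have "d\<^sup>2 \<le> 5 * M ^ 3 * W"
    proof -
      have "\<bar>d\<bar> * \<bar>d\<bar> \<le> 5 * M ^ 3 * \<rho> * \<bar>d\<bar>" using d by (intro mult_right_mono) auto
      then show ?thesis by (simp add: W_def power2_eq_square mult.assoc)
    qed
    also have "g\<^sup>2 \<le> 16 * M ^ 6 * U"
    proof -
      have "\<bar>g\<bar>\<^sup>2 \<le> (4 * M ^ 3 * u\<^sup>2)\<^sup>2" using g by (intro power_mono) auto
      then show ?thesis by (simp add: U_def power_mult_distrib flip: power_mult)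
    qed
    finally show ?thesis by simp
  qed
  have uv: "u\<^sup>2 * \<bar>v\<bar> \<le> W + 4 * M ^ 3 * U"
  proof -
    have "\<bar>v\<bar> \<le> \<bar>d\<bar> + 4 * M ^ 3 * u\<^sup>2" using g unfolding d_def by linarith
    then have "u\<^sup>2 * \<bar>v\<bar> \<le> u\<^sup>2 * (\<bar>d\<bar> + 4 * M ^ 3 * u\<^sup>2)" by (intro mult_left_mono) auto
    also have "\<dots> = u\<^sup>2 * \<bar>d\<bar> + 4 * M ^ 3 * U" by (simp add: U_def eval_nat_numeral algebra_simps)
    also have "u\<^sup>2 * \<bar>d\<bar> \<le> W" unfolding W_def using uu by (intro mult_right_mono) auto
    finally show ?thesis by simp
  qed
  have T1: "\<bar>2 * A * f1 * u * (d + c * u ^ 3)\<bar> \<le> 2 * M\<^sup>2 * W + 6 * M ^ 5 * U"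
  proof -
    have "\<bar>u\<bar> * \<bar>d + c * u ^ 3\<bar> \<le> W + 3 * M ^ 3 * U"
    proof -
      have "\<bar>u\<bar> * \<bar>d\<bar> \<le> W" unfolding W_def using u by (intro mult_right_mono) auto
      moreover have "\<bar>u\<bar> * \<bar>c * u ^ 3\<bar> \<le> 3 * M ^ 3 * U"
      proof -
        have "\<bar>c\<bar> * U \<le> 3 * M ^ 3 * U" using c W0 by (intro mult_right_mono) auto
        moreover have "\<bar>u\<bar> * \<bar>c * u ^ 3\<bar> = \<bar>c\<bar> * U"
        proof -
          have "\<bar>u\<bar> * \<bar>c * u ^ 3\<bar> = \<bar>c\<bar> * \<bar>u ^ 4\<bar>" by (simp add: eval_nat_numeral abs_mult)
          then show ?thesis by (simp add: U_def)
        qed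
        ultimately show ?thesis by simp
      qed
      moreover have "\<bar>u\<bar> * \<bar>d + c * u ^ 3\<bar> \<le> \<bar>u\<bar> * (\<bar>d\<bar> + \<bar>c * u ^ 3\<bar>)" by (intro mult_left_mono) auto
      ultimately show ?thesis by (simp add: distrib_left)
    qed
    moreover have "\<bar>2 * A * f1\<bar> \<le> 2 * M\<^sup>2"
      using mult_mono[OF A M(2)] M by (simp add: abs_mult power2_eq_square)
    ultimately have "\<bar>2 * A * f1\<bar> * (\<bar>u\<bar> * \<bar>d + c * u ^ 3\<bar>) \<le> 2 * M\<^sup>2 * (W + 3 * M ^ 3 * U)"
      by (intro mult_mono) auto
    also have "\<dots> = 2 * M\<^sup>2 * W + 6 * M ^ 5 * U" by (simp add: eval_nat_numeral algebra_simps)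
    finally show ?thesis by (simp add: abs_mult)
  qed
  have T2: "\<bar>A * f1\<^sup>2 * v\<^sup>2\<bar> \<le> M ^ 3 * v\<^sup>2"
  proof -
    have "\<bar>A\<bar> * \<bar>f1\<bar>\<^sup>2 \<le> M * M\<^sup>2" using A M by (intro mult_mono power_mono) auto
    then have "\<bar>A\<bar> * \<bar>f1\<bar>\<^sup>2 * v\<^sup>2 \<le> M ^ 3 * v\<^sup>2" by (intro mult_right_mono) (auto simp: eval_nat_numeral)
    then show ?thesis by (simp add: abs_mult)
  qed
  \<comment> \<open>Every term of (u - f1 v)^3 - u^3 contains u^2 v or v^2, and \<open>uv\<close>
    and \<open>v2\<close> express these through \<open>W\<close> and \<open>U\<close>.\<close>
  have T3: "\<bar>B * ((u - f1 * v) ^ 3 - u ^ 3)\<bar> \<le> 3 * M\<^sup>2 * (u\<^sup>2 * \<bar>v\<bar>) + (3 * M ^ 3 + M ^ 4) * v\<^sup>2"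
  proof -
    define w where "w = f1 * v"
    have w: "\<bar>w\<bar> \<le> M * \<bar>v\<bar>" using M by (simp add: w_def abs_mult mult_right_mono)
    have w2: "w\<^sup>2 \<le> M\<^sup>2 * v\<^sup>2" using power_mono[OF w, of 2] by (simp add: power_mult_distrib)
    have w1: "\<bar>w\<bar> \<le> M" using w v1 M by (meson mult_left_le order_trans abs_ge_zero le_numeral_extra(1) dual_order.trans)
    have "(u - w) ^ 3 - u ^ 3 = - (3 * (u\<^sup>2 * w)) + 3 * (u * w\<^sup>2) - w * w\<^sup>2"
      by (simp add: eval_nat_numeral algebra_simps)
    then have "\<bar>(u - w) ^ 3 - u ^ 3\<bar> \<le> \<bar>3 * (u\<^sup>2 * w)\<bar> + \<bar>3 * (u * w\<^sup>2)\<bar> + \<bar>w * w\<^sup>2\<bar>" by linarith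
    also have "\<dots> = 3 * (u\<^sup>2 * \<bar>w\<bar>) + 3 * (\<bar>u\<bar> * w\<^sup>2) + \<bar>w\<bar> * w\<^sup>2" by (simp add: abs_mult)
    also have "\<dots> \<le> 3 * (u\<^sup>2 * (M * \<bar>v\<bar>)) + 3 * (1 * (M\<^sup>2 * v\<^sup>2)) + M * (M\<^sup>2 * v\<^sup>2)"
      using w w2 w1 u1 M by (intro add_mono mult_left_mono mult_mono) auto
    finally have "\<bar>(u - w) ^ 3 - u ^ 3\<bar> \<le> 3 * (u\<^sup>2 * (M * \<bar>v\<bar>)) + 3 * (1 * (M\<^sup>2 * v\<^sup>2)) + M * (M\<^sup>2 * v\<^sup>2)" .
    then have "\<bar>B\<bar> * \<bar>(u - w) ^ 3 - u ^ 3\<bar> \<le> M * (3 * (u\<^sup>2 * (M * \<bar>v\<bar>)) + 3 * (1 * (M\<^sup>2 * v\<^sup>2)) + M * (M\<^sup>2 * v\<^sup>2))"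
      using B M by (intro mult_mono) auto
    also have "\<dots> = 3 * M\<^sup>2 * (u\<^sup>2 * \<bar>v\<bar>) + (3 * M ^ 3 + M ^ 4) * v\<^sup>2"
      by (simp add: eval_nat_numeral algebra_simps)
    finally show ?thesis by (simp add: w_def abs_mult)
  qed
  have T4: "\<bar>R / L\<bar> \<le> 8 * M * U + 8 * M * v\<^sup>2"
  proof -
    have t: "\<bar>t\<bar> \<le> \<bar>u\<bar> + \<bar>v\<bar>"
    proof -
      have "\<bar>u\<bar> \<le> L * \<bar>u\<bar>" using L by (simp add: mult_right_mono[of 1 L "\<bar>u\<bar>", simplified])
      moreover have "\<bar>f1 * v\<bar> \<le> L * \<bar>v\<bar>" using L by (simp add: abs_mult mult_right_mono)
      ultimately have "\<bar>u - f1 * v\<bar> \<le> L * (\<bar>u\<bar> + \<bar>v\<bar>)" by (simp add: distrib_left)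
      then show ?thesis using L0 by (simp add: t_def divide_le_eq mult.commute)
    qed
    have sq: "(a + b)\<^sup>2 \<le> 2 * a\<^sup>2 + 2 * b\<^sup>2" for a b :: real
      using zero_le_power2[of "a - b"] by (simp add: power2_eq_square algebra_simps)
    have "t ^ 4 = ((\<bar>t\<bar>)\<^sup>2)\<^sup>2" by simp
    also have "\<dots> \<le> ((\<bar>u\<bar> + \<bar>v\<bar>)\<^sup>2)\<^sup>2" using t by (intro power_mono) auto
    also have "\<dots> \<le> (2 * u\<^sup>2 + 2 * v\<^sup>2)\<^sup>2" using sq[of "\<bar>u\<bar>" "\<bar>v\<bar>"] by (intro power_mono) auto
    also have "\<dots> \<le> 2 * (2 * u\<^sup>2)\<^sup>2 + 2 * (2 * v\<^sup>2)\<^sup>2" by (rule sq)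
    also have "\<dots> = 8 * U + 8 * v ^ 4" by (simp add: U_def power_mult_distrib flip: power_mult)
    also have "v ^ 4 \<le> v\<^sup>2" using power_decreasing[of 2 4 "\<bar>v\<bar>"] v1 by simp
    finally have "M * t ^ 4 \<le> M * (8 * U + 8 * v\<^sup>2)" using M by (intro mult_left_mono) auto
    moreover have "\<bar>R / L\<bar> \<le> \<bar>R\<bar>"
    proof -
      have "\<bar>R\<bar> / L \<le> \<bar>R\<bar> / 1" using L by (intro divide_left_mono) auto
      then show ?thesis using L0 by simp
    qed
    ultimately show ?thesis using R by (simp add: distrib_left)
  qed
  \<comment> \<open>442 = 18 + 8 + 416 is the sum of the coefficients at \<open>U\<close>, with 416
    = 13 * 32, and every power of \<open>M\<close> is raised to the tenth. Twice this number is the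
    884 in \<open>C\<close>.\<close>
  have X: "\<bar>X\<bar> \<le> 442 * M ^ 10 * W + 442 * M ^ 10 * U"
  proof -
    have "\<bar>X\<bar> \<le> 2 * M\<^sup>2 * W + 6 * M ^ 5 * U + 3 * M\<^sup>2 * (u\<^sup>2 * \<bar>v\<bar>) + 8 * M * U + (4 * M ^ 3 + M ^ 4 + 8 * M) * v\<^sup>2"
    proof -
      have "\<bar>x1 - x2 - x3 - x4\<bar> \<le> \<bar>x1\<bar> + \<bar>x2\<bar> + \<bar>x3\<bar> + \<bar>x4\<bar>" for x1 x2 x3 x4 :: real by linarith
      from this[of "2 * A * f1 * u * (d + c * u ^ 3)" "A * f1\<^sup>2 * v\<^sup>2" "B * ((u - f1 * v) ^ 3 - u ^ 3)" "R / L"]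
      show ?thesis
        using T1 T2 T3 T4 unfolding X_def[symmetric] distrib_right by linarith
    qed
    also have "\<dots> \<le> 2 * M\<^sup>2 * W + 6 * M ^ 5 * U + 3 * M\<^sup>2 * (W + 4 * M ^ 3 * U) + 8 * M * U + 13 * M ^ 4 * (10 * M ^ 3 * W + 32 * M ^ 6 * U)"
    proof -
      have "4 * M ^ 3 + M ^ 4 + 8 * M \<le> 13 * M ^ 4" using Mpow[of 3 4] Mpow[of 1 4] by simp
      then have "(4 * M ^ 3 + M ^ 4 + 8 * M) * v\<^sup>2 \<le> 13 * M ^ 4 * (10 * M ^ 3 * W + 32 * M ^ 6 * U)"
        using v2 M by (intro mult_mono) auto
      moreover have "3 * M\<^sup>2 * (u\<^sup>2 * \<bar>v\<bar>) \<le> 3 * M\<^sup>2 * (W + 4 * M ^ 3 * U)"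
        using uv by (intro mult_left_mono) auto
      ultimately show ?thesis by linarith
    qed
    also have "\<dots> = (5 * M\<^sup>2 + 130 * M ^ 7) * W + (18 * M ^ 5 + 8 * M + 416 * M ^ 10) * U"
      by (simp add: algebra_simps flip: power_add)
    also have "\<dots> \<le> 442 * M ^ 10 * W + 442 * M ^ 10 * U"
      using W0 Mpow[of 2 10] Mpow[of 7 10] Mpow[of 5 10] Mpow[of 1 10] M1[of 10]
      by (intro add_mono mult_right_mono) auto
    finally show ?thesis .
  qed
  have small: "442 * M ^ 10 * W \<le> \<bar>d\<bar> / 2"
  proof -
    have "442 * M ^ 10 * \<rho> \<le> 1 / 2" using \<rho> \<rho>0 M1[of 10] by (simp add: C_def)
    then have "442 * M ^ 10 * \<rho> * \<bar>d\<bar> \<le> 1 / 2 * \<bar>d\<bar>" by (intro mult_right_mono) auto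
    then show ?thesis by (simp add: W_def mult.assoc)
  qed
  \<comment> \<open>If \<bar>d\<bar> > C U, the right side is below \<bar>d\<bar>, so d + X keeps
    the sign of \<open>d\<close>.\<close>
  have XU: "\<bar>X\<bar> \<le> \<bar>d\<bar> / 2 + C * U / 2" 
  proof -
    have "C * U / 2 = 442 * M ^ 10 * U" by (simp add: C_def)
    then show ?thesis using X small by linarith
  qed
  have CU: "0 \<le> C * U" using C1 W0 by simp
  {
    assume "A * u\<^sup>2 + c * u ^ 3 + C * u ^ 4 < v"
    then have "C * U < d" by (simp add: d_def g_def U_def)
    then have "0 < \<Phi> / L" using XU CU unfolding key by linarith
    then show "0 < \<Phi>" using L0 by (simp add: zero_less_divide_iff)
  next
    assume "v < A * u\<^sup>2 + c * u ^ 3 - C * u ^ 4"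
    then have "d < - (C * U)" by (simp add: d_def g_def U_def)
    then have "\<Phi> / L < 0" using XU CU unfolding key by linarith
    then show "\<Phi> < 0" using L0 by (simp add: divide_less_0_iff)
  }
qed

section \<open>The renormalized potential as an integral over the exterior\<close>

lemma frame_inner [simp]:
  assumes "norm e = 1"
  shows "e \<bullet> frame 0 e p = fst p" "rot90 e \<bullet> frame 0 e p = snd p"
  using assms by (simp_all add: frame_def inner_right_distrib norm_eq_1)

lemma C_infinity_differentiable: "C_infinity f \<Longrightarrow> f differentiable (at t)"
  unfolding C_infinity_def by (metis funpow_0)

text \<open>Names the chart data hidden behind the existential quantifiers of
  \<open>smooth_boundary\<close>, so that the curvature formula and the potential estimate can speak
  about the same chart.\<close>

definition graph_chart :: "(real^2) set \<Rightarrow> real^2 \<Rightarrow> real^2 \<Rightarrow> (real \<Rightarrow> real) \<Rightarrow> real \<Rightarrow> bool" where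
  "graph_chart \<Omega> p e f r \<longleftrightarrow> 0 < r \<and> norm e = 1 \<and> C_infinity f \<and>
     (\<forall>z \<in> ball p r.
        (z \<in> interior \<Omega> \<longleftrightarrow> f (e \<bullet> z) < rot90 e \<bullet> z) \<and>
        (z \<in> frontier \<Omega> \<longleftrightarrow> f (e \<bullet> z) = rot90 e \<bullet> z))"

lemma smooth_boundary_iff_graph_chart:
  "smooth_boundary \<Omega> \<longleftrightarrow> (\<forall>p \<in> frontier \<Omega>. \<exists>e f r. graph_chart \<Omega> p e f r)"
  unfolding smooth_boundary_def graph_chart_def by blast

text \<open>Negligibility is local, and inside a chart the frontier lies in the image of a line
  under a differentiable map into the plane.\<close>

lemma smooth_boundary_imp_negligible_frontier:
  assumes "smooth_boundary \<Omega>"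
  shows "negligible (frontier \<Omega>)"
proof (subst locally_negligible_alt, rule ballI)
  fix p assume p: "p \<in> frontier \<Omega>"
  obtain e f r where "graph_chart \<Omega> p e f r"
    using assms p smooth_boundary_iff_graph_chart by blast
  then have r: "0 < r" and e: "norm e = 1" and f: "C_infinity f"
    and chart: "\<forall>z \<in> ball p r. z \<in> frontier \<Omega> \<longleftrightarrow> f (e \<bullet> z) = rot90 e \<bullet> z"
    by (auto simp: graph_chart_def)
  have "negligible ((\<lambda>s. frame 0 e (s, f s)) ` UNIV)"
  proof (rule negligible_differentiable_image_lowdim)
    show "(\<lambda>s. frame 0 e (s, f s)) differentiable_on UNIV"
      using C_infinity_differentiable[OF f]
      by (auto simp: frame_def differentiable_on_def intro!: derivative_intros)
  qed simp
  moreover have "frontier \<Omega> \<inter> ball p r \<subseteq> (\<lambda>s. frame 0 e (s, f s)) ` UNIV"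
  proof
    fix z assume "z \<in> frontier \<Omega> \<inter> ball p r"
    then have "f (e \<bullet> z) = rot90 e \<bullet> z" using chart by blast
    then have "z = frame 0 e (e \<bullet> z, f (e \<bullet> z))" using frame_expand[OF e, of z 0] by simp
    then show "z \<in> (\<lambda>s. frame 0 e (s, f s)) ` UNIV" by blast
  qed
  ultimately have "negligible (frontier \<Omega> \<inter> ball p r)" by (rule negligible_subset)
  moreover have "openin (top_of_set (frontier \<Omega>)) (frontier \<Omega> \<inter> ball p r)" by (simp add: openin_open_Int)
  ultimately show "\<exists>U. openin (top_of_set (frontier \<Omega>)) U \<and> p \<in> U \<and> negligible U"
    using p r by (intro exI[of _ "frontier \<Omega> \<inter> ball p r"]) auto
qed

text \<open>For \<epsilon> < \<delta> the removed disc lies in the interior, so the term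
  \<open>pi / \<epsilon>\<^sup>2\<close> is cancelled exactly and the expression under the limit
  does not depend on \<epsilon>.\<close>

lemma renormalized_potential_eq_exterior:
  assumes neg: "negligible (frontier \<Omega>)" and \<delta>: "0 < \<delta>" and ball: "ball w \<delta> \<subseteq> interior \<Omega>"
  shows "renormalized_potential w \<Omega> = - (\<integral>z. indicator (- interior \<Omega>) z * (1 / norm (z - w) ^ 4) \<partial>lborel)"
proof -
  define U where "U = interior \<Omega>"
  define \<phi> where "\<phi> z = 1 / norm (z - w) ^ 4" for z
  have [measurable]: "\<phi> \<in> borel_measurable borel" unfolding \<phi>_def by measurable
  have [measurable]: "U \<in> sets borel" by (simp add: U_def)
  \<comment> \<open>Apart from its interior, \<Omega> is a subset of the null frontier, hence
    measurable by completeness.\<close>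
  have \<Omega>: "\<Omega> \<in> sets lebesgue"
  proof -
    have "\<Omega> = U \<union> (\<Omega> \<inter> frontier \<Omega>)"
      using interior_subset[of \<Omega>] closure_subset[of \<Omega>] by (auto simp: U_def frontier_def)
    moreover have "\<Omega> \<inter> frontier \<Omega> \<in> sets lebesgue"
      using neg by (intro negligible_imp_sets) (auto intro: negligible_subset)
    moreover have "U \<in> sets lebesgue" by simp
    ultimately show ?thesis by (metis sets.Un)
  qed
  have outside: "has_bochner_integral lborel (\<lambda>z. indicator (- ball w \<epsilon>) z * \<phi> z) (pi / \<epsilon>\<^sup>2)" if "0 < \<epsilon>" for \<epsilon>
    unfolding \<phi>_def using that by (intro has_integral_inverse_fourth_power_outside_ball) auto
  have intU: "integrable lborel (\<lambda>z. indicator (- U) z * \<phi> z)"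
  proof (rule Bochner_Integration.integrable_bound)
    show "integrable lborel (\<lambda>z. indicator (- ball w \<delta>) z * \<phi> z)"
      using outside[OF \<delta>] by (simp add: has_bochner_integral_iff)
    show "AE z in lborel. norm (indicator (- U) z * \<phi> z) \<le> norm (indicator (- ball w \<delta>) z * \<phi> z)"
      using ball by (intro AE_I2) (auto simp: indicator_def U_def)
  qed measurable
  have val: "(LINT z:\<Omega> - ball w \<epsilon>|lebesgue. 1 / norm (z - w) ^ 4) - pi / \<epsilon>\<^sup>2 = - (\<integral>z. indicator (- U) z * \<phi> z \<partial>lborel)"
    if \<epsilon>: "0 < \<epsilon>" "\<epsilon> < \<delta>" for \<epsilon>
  proof -
    have \<phi>l: "\<phi> \<in> borel_measurable lebesgue" by (rule measurable_completion) simp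
    have "(LINT z:\<Omega> - ball w \<epsilon>|lebesgue. 1 / norm (z - w) ^ 4) = (\<integral>z. indicator (\<Omega> - ball w \<epsilon>) z * \<phi> z \<partial>lebesgue)"
      by (simp add: set_lebesgue_integral_def \<phi>_def)
    also have "\<dots> = (\<integral>z. indicator (U - ball w \<epsilon>) z * \<phi> z \<partial>lebesgue)"
    proof (rule integral_cong_AE)
      show "(\<lambda>z. indicator (\<Omega> - ball w \<epsilon>) z * \<phi> z) \<in> borel_measurable lebesgue"
        using \<Omega> \<phi>l by (intro borel_measurable_times borel_measurable_indicator sets.Diff) auto
      show "(\<lambda>z. indicator (U - ball w \<epsilon>) z * \<phi> z) \<in> borel_measurable lebesgue"
        using \<phi>l by (intro borel_measurable_times borel_measurable_indicator) auto
      have "AE z in lebesgue. z \<notin> frontier \<Omega>"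
        using neg by (intro AE_not_in) (simp add: negligible_iff_null_sets)
      then show "AE z in lebesgue. indicator (\<Omega> - ball w \<epsilon>) z * \<phi> z = indicator (U - ball w \<epsilon>) z * \<phi> z"
      proof eventually_elim
        case (elim z)
        then have "z \<in> \<Omega> \<longleftrightarrow> z \<in> U"
          using interior_subset[of \<Omega>] closure_subset[of \<Omega>] by (auto simp: U_def frontier_def)
        then show ?case by (simp add: indicator_def)
      qed
    qed
    also have "\<dots> = (\<integral>z. indicator (U - ball w \<epsilon>) z * \<phi> z \<partial>lborel)"
      by (intro integral_completion borel_measurable_times borel_measurable_indicator) simp_all
    also have "\<dots> = (\<integral>z. indicator (- ball w \<epsilon>) z * \<phi> z - indicator (- U) z * \<phi> z \<partial>lborel)"
      using ball \<epsilon> by (intro Bochner_Integration.integral_cong) (auto simp: indicator_def U_def subset_iff)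
    also have "\<dots> = pi / \<epsilon>\<^sup>2 - (\<integral>z. indicator (- U) z * \<phi> z \<partial>lborel)"
      using outside[OF \<epsilon>(1)] intU by (simp add: has_bochner_integral_iff)
    finally show ?thesis by simp
  qed
  have "\<forall>\<^sub>F \<epsilon> in at_right 0. - (\<integral>z. indicator (- U) z * \<phi> z \<partial>lborel)
     = (LINT z:\<Omega> - ball w \<epsilon>|lebesgue. 1 / norm (z - w) ^ 4) - pi / \<epsilon>\<^sup>2"
    by (rule eventually_at_rightI[OF _ \<delta>]) (simp only: val greaterThanLessThan_iff)
  then have "((\<lambda>\<epsilon>. (LINT z:\<Omega> - ball w \<epsilon>|lebesgue. 1 / norm (z - w) ^ 4) - pi / \<epsilon>\<^sup>2)
       \<longlongrightarrow> - (\<integral>z. indicator (- U) z * \<phi> z \<partial>lborel)) (at_right 0)"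
    by (rule Lim_transform_eventually[OF tendsto_const])
  then show ?thesis
    unfolding renormalized_potential_def by (simp add: tendsto_Lim U_def \<phi>_def)
qed

lemma integral_exterior_frame:
  assumes \<tau>: "norm \<tau> = 1" and U: "U \<in> sets borel"
  shows "(\<integral>z. indicator U z * (1 / norm (z - frame q \<tau> p) ^ 4) \<partial>lborel)
     = (\<integral>z. indicator (frame q \<tau> -` U) z * (1 / norm (z - p) ^ 4) \<partial>lborel)"
proof -
  note [measurable] = U
  have "(\<integral>z. indicator U z * (1 / norm (z - frame q \<tau> p) ^ 4) \<partial>lborel)
     = (\<integral>z. indicator U z * (1 / norm (z - frame q \<tau> p) ^ 4) \<partial>distr lborel borel (frame q \<tau>))"
    by (simp only: distr_lborel_frame[OF \<tau>])
  also have "\<dots> = (\<integral>z. indicator U (frame q \<tau> z) * (1 / norm (frame q \<tau> z - frame q \<tau> p) ^ 4) \<partial>lborel)"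
    by (rule integral_distr) measurable
  finally show ?thesis by (simp add: dist_frame[OF \<tau>] indicator_vimage)
qed

section \<open>Curvature in a graph chart\<close>

text \<open>Used to see that the parametrized graph of a smooth function is a smooth curve in the
  plane.\<close>

lemma C_infinity_linear_combination:
  fixes f g :: "real \<Rightarrow> real" and a b :: "real^2"
  assumes "C_infinity f" "C_infinity g"
  shows "C_infinity (\<lambda>s. f s *\<^sub>R a + g s *\<^sub>R b)"
proof -
  let ?D = "\<lambda>k. ((\<lambda>g s. vector_derivative g (at s)) ^^ k)"
  have der: "((\<lambda>s. ?D k f s *\<^sub>R a + ?D k g s *\<^sub>R b) has_vector_derivative
      ?D (Suc k) f t *\<^sub>R a + ?D (Suc k) g t *\<^sub>R b) (at t)" for k t
    using C_infinity_has_vector_derivative[OF assms(1), of k t] C_infinity_has_vector_derivative[OF assms(2), of k t]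
    unfolding has_real_derivative_iff_has_vector_derivative[symmetric]
    by (auto intro!: derivative_eq_intros)
  have eq: "?D k (\<lambda>s. f s *\<^sub>R a + g s *\<^sub>R b) = (\<lambda>s. ?D k f s *\<^sub>R a + ?D k g s *\<^sub>R b)" for k
  proof (induction k)
    case (Suc k)
    have "?D (Suc k) (\<lambda>s. f s *\<^sub>R a + g s *\<^sub>R b)
        = (\<lambda>t. vector_derivative (\<lambda>s. ?D k f s *\<^sub>R a + ?D k g s *\<^sub>R b) (at t))"
      by (simp add: Suc.IH)
    also have "\<dots> = (\<lambda>t. ?D (Suc k) f t *\<^sub>R a + ?D (Suc k) g t *\<^sub>R b)"
      by (rule ext) (rule vector_derivative_at[OF der])
    finally show ?case .
  qed simp
  show ?thesis
    unfolding C_infinity_def eq using differentiableI_vector[OF der] by blast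
qed

lemma C_infinity_ident: "C_infinity (\<lambda>s::real. s)"
proof -
  let ?D = "\<lambda>k. ((\<lambda>g s. vector_derivative g (at s)) ^^ k) (\<lambda>s::real. s)"
  have D: "?D k = (\<lambda>s. s) \<or> ?D k = (\<lambda>_. 1) \<or> ?D k = (\<lambda>_. 0)" for k
    by (induction k) auto
  have "?D k differentiable (at t)" for k t
    using D[of k] by (elim disjE) (simp_all only: differentiable_ident differentiable_const)
  then show ?thesis by (simp add: C_infinity_def)
qed

lemma isCont_eventually_nhds:
  assumes "isCont g x" "open S" "g x \<in> S"
  shows "\<forall>\<^sub>F s in nhds x. g s \<in> S"
  using assms unfolding continuous_at tendsto_at_iff_tendsto_nhds by (intro topological_tendstoD)

text \<open>The numerator of the curvature is a determinant, so it is the same in the rotated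
  orthonormal basis of the chart.\<close>

lemma inner_curvature_numerator:
  assumes "norm e = 1"
  shows "v $ 1 * a $ 2 - v $ 2 * a $ 1 = (e \<bullet> v) * (rot90 e \<bullet> a) - (rot90 e \<bullet> v) * (e \<bullet> a)"
proof -
  have e: "e $ 1 * e $ 1 + e $ 2 * e $ 2 = 1"
    using assms by (simp add: norm_eq_1 inner_real2)
  have "(e \<bullet> v) * (rot90 e \<bullet> a) - (rot90 e \<bullet> v) * (e \<bullet> a)
      = (e $ 1 * e $ 1 + e $ 2 * e $ 2) * (v $ 1 * a $ 2 - v $ 2 * a $ 1)"
    unfolding inner_real2 rot90_nth by algebra
  then show ?thesis by (simp add: e)
qed

lemma norm_frame_coordinates:
  assumes "norm e = 1"
  shows "(norm v)\<^sup>2 = (e \<bullet> v)\<^sup>2 + (rot90 e \<bullet> v)\<^sup>2"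
proof -
  have e: "e $ 1 * e $ 1 + e $ 2 * e $ 2 = 1"
    using assms by (simp add: norm_eq_1 inner_real2)
  have "(e \<bullet> v)\<^sup>2 + (rot90 e \<bullet> v)\<^sup>2 = (e $ 1 * e $ 1 + e $ 2 * e $ 2) * (v \<bullet> v)"
    unfolding inner_real2 rot90_nth by algebra
  then show ?thesis by (simp add: e power2_norm_eq_inner)
qed

lemma inner_rot90_rot90: "e \<bullet> rot90 v = - (rot90 e \<bullet> v)"
  by (simp add: inner_real2)

text \<open>Near \<open>t\<close> the curve stays on the graph. Differentiating y = f(x) twice gives
  y' = f' x' and y'' = f'' x'^2 + f' x'', so the numerator is f'' x'^3 and the speed is
  \<bar>x'\<bar> L. The parametrization cancels once x' > 0, which is what the orientation
  provides.\<close>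

lemma oriented_boundary_curve_curvature:
  fixes f :: "real \<Rightarrow> real"
  assumes chart: "graph_chart \<Omega> p e f r" and q: "\<gamma> t \<in> ball p r" and \<gamma>: "oriented_boundary_curve \<Omega> \<gamma> t"
    and D: "D = (\<lambda>k. ((\<lambda>g s. vector_derivative g (at s)) ^^ k) f)"
  shows "curve_curvature \<gamma> t = D 2 (e \<bullet> \<gamma> t) / sqrt (1 + (D 1 (e \<bullet> \<gamma> t))\<^sup>2) ^ 3"
proof -
  have e: "norm e = 1" and f: "C_infinity f"
    and int: "\<And>z. z \<in> ball p r \<Longrightarrow> z \<in> interior \<Omega> \<longleftrightarrow> f (e \<bullet> z) < rot90 e \<bullet> z"
    and fro: "\<And>z. z \<in> ball p r \<Longrightarrow> z \<in> frontier \<Omega> \<longleftrightarrow> f (e \<bullet> z) = rot90 e \<bullet> z"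
    using chart by (auto simp: graph_chart_def)
  have fder: "(D k has_real_derivative D (Suc k) s) (at s)" for k s
    unfolding D has_real_derivative_iff_has_vector_derivative by (rule C_infinity_has_vector_derivative[OF f])
  have f1: "(f has_real_derivative D 1 s) (at s)" for s using fder[of 0] by (simp add: D)
  have f2: "(D 1 has_real_derivative D 2 s) (at s)" for s using fder[of 1] by (simp add: numeral_2_eq_2)
  define V where "V s = vector_derivative \<gamma> (at s)" for s
  define a where "a = vector_derivative V (at t)"
  have C: "C_infinity \<gamma>" and V0: "V t \<noteq> 0" and ev: "\<forall>\<^sub>F s in nhds t. \<gamma> s \<in> frontier \<Omega>"
    and right: "\<forall>\<^sub>F h in at_right 0. \<gamma> t + h *\<^sub>R rot90 (V t) \<in> interior \<Omega>"
    using \<gamma> by (auto simp: oriented_boundary_curve_def V_def)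
  have V: "(\<gamma> has_vector_derivative V s) (at s)" for s
    using C_infinity_has_vector_derivative[OF C, of 0 s] by (simp add: V_def)
  have a: "(V has_vector_derivative a) (at t)"
    using C_infinity_has_vector_derivative[OF C, of 1 t] by (simp add: V_def[abs_def] a_def)
  have coord: "((\<lambda>s. b \<bullet> F s) has_real_derivative b \<bullet> F') (at s)"
    if "(F has_vector_derivative F') (at s)" for b :: "real^2" and F F' s
    using bounded_linear.has_vector_derivative[OF bounded_linear_inner_right that]
    by (simp add: has_real_derivative_iff_has_vector_derivative)
  define x where "x = e \<bullet> \<gamma> t"
  define X where "X = e \<bullet> V t"
  define Y where "Y = rot90 e \<bullet> V t"
  have "isCont \<gamma> t" using V by (rule has_vector_derivative_continuous)
  then have "\<forall>\<^sub>F s in nhds t. \<gamma> s \<in> ball p r"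
    using q by (intro isCont_eventually_nhds) auto
  \<comment> \<open>Valid on a whole neighbourhood of \<open>t\<close>, so that the relation can be
    differentiated at every nearby s, and the result again at \<open>t\<close>.\<close>
  with ev have on_graph: "\<forall>\<^sub>F s in nhds t. rot90 e \<bullet> \<gamma> s = f (e \<bullet> \<gamma> s)"
    by eventually_elim (simp add: fro)
  have "\<forall>\<^sub>F s in nhds t. rot90 e \<bullet> V s = D 1 (e \<bullet> \<gamma> s) * (e \<bullet> V s)"
    using on_graph[THEN eventually_eventually[THEN iffD2]]
  proof eventually_elim
    case (elim s)
    have "((\<lambda>s. f (e \<bullet> \<gamma> s)) has_real_derivative D 1 (e \<bullet> \<gamma> s) * (e \<bullet> V s)) (at s)"
      by (rule DERIV_chain2[OF f1 coord[OF V]])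
    then have "((\<lambda>s. rot90 e \<bullet> \<gamma> s) has_real_derivative D 1 (e \<bullet> \<gamma> s) * (e \<bullet> V s)) (at s)"
      using elim by (subst DERIV_cong_ev[OF refl _ refl, of _ "\<lambda>s. f (e \<bullet> \<gamma> s)"]) auto
    then show ?case using coord[OF V] DERIV_unique by blast
  qed
  note ev1 = this
  have Y: "Y = D 1 x * X" using eventually_nhds_x_imp_x[OF ev1] by (simp add: X_def Y_def x_def)
  have "((\<lambda>s. D 1 (e \<bullet> \<gamma> s) * (e \<bullet> V s)) has_real_derivative D 2 x * X * X + e \<bullet> a * D 1 x) (at t)"
    using DERIV_mult[OF DERIV_chain2[OF f2 coord[OF V]] coord[OF a]] by (simp add: X_def x_def)
  then have "((\<lambda>s. rot90 e \<bullet> V s) has_real_derivative D 2 x * X * X + e \<bullet> a * D 1 x) (at t)"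
    by (subst DERIV_cong_ev[OF refl ev1 refl])
  then have a2: "rot90 e \<bullet> a = D 2 x * X * X + e \<bullet> a * D 1 x"
    using coord[OF a] DERIV_unique by blast
  define L where "L = sqrt (1 + (D 1 x)\<^sup>2)"
  have L: "0 < L" "L\<^sup>2 = 1 + (D 1 x)\<^sup>2" by (auto simp: L_def add_pos_nonneg)
  have nV: "(norm (V t))\<^sup>2 = X\<^sup>2 * L\<^sup>2"
    unfolding norm_frame_coordinates[OF e] X_def[symmetric] Y_def[symmetric] L(2) Y
    by (simp add: power_mult_distrib algebra_simps)
  have "X \<noteq> 0" using nV V0 by auto
  \<comment> \<open>Along the rotated velocity the height above the graph, \<open>?\<psi>\<close>,
    starts at 0 with slope X L^2. For X < 0 the points to the left of the curve would lie below the
    graph, outside the interior.\<close>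
  have "0 \<le> X"
  proof (rule ccontr)
    assume neg: "\<not> 0 \<le> X"
    let ?\<psi> = "\<lambda>h. rot90 e \<bullet> \<gamma> t + h * X - f (x - h * Y)"
    have "(?\<psi> has_real_derivative X - D 1 (x - 0 * Y) * (- Y)) (at 0)"
      by (rule derivative_eq_intros DERIV_chain2[OF f1] refl | simp)+
    moreover have "X - D 1 (x - 0 * Y) * (- Y) = X * L\<^sup>2"
      unfolding L(2) Y by (simp add: power2_eq_square algebra_simps)
    moreover have "X * L\<^sup>2 < 0" using neg L(1) by (intro mult_neg_pos) auto
    ultimately obtain d where d: "d > 0" "\<And>h. 0 < h \<Longrightarrow> h < d \<Longrightarrow> ?\<psi> h < ?\<psi> 0"
      using DERIV_neg_dec_right[of ?\<psi> _ 0] by auto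
    have base: "rot90 e \<bullet> \<gamma> t = f x" using eventually_nhds_x_imp_x[OF on_graph] by (simp add: x_def)
    have "((\<lambda>h. \<gamma> t + h *\<^sub>R rot90 (V t)) \<longlongrightarrow> \<gamma> t + 0 *\<^sub>R rot90 (V t)) (at_right 0)"
      by (intro tendsto_intros)
    then have "\<forall>\<^sub>F h in at_right 0. \<gamma> t + h *\<^sub>R rot90 (V t) \<in> ball p r"
      using q by (intro topological_tendstoD) auto
    moreover have "\<forall>\<^sub>F h in at_right 0. 0 < h \<and> h < d"
      by (rule eventually_at_rightI[OF _ d(1)]) simp
    ultimately have "\<forall>\<^sub>F h in at_right (0::real). False"
      using right
    proof eventually_elim
      case (elim h)
      then have "f (e \<bullet> (\<gamma> t + h *\<^sub>R rot90 (V t))) < rot90 e \<bullet> (\<gamma> t + h *\<^sub>R rot90 (V t))"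
        using int by blast
      then have "0 < ?\<psi> h"
        by (simp add: inner_right_distrib inner_rot90_rot90[of e] x_def X_def Y_def)
      moreover have "?\<psi> h < ?\<psi> 0" using d(2) elim by blast
      ultimately show False by (simp add: base)
    qed
    then show False by simp
  qed
  with \<open>X \<noteq> 0\<close> have X: "0 < X" by simp
  have "norm (V t) = X * L"
  proof -
    have "(norm (V t))\<^sup>2 = (X * L)\<^sup>2" by (simp only: nV power_mult_distrib)
    then show ?thesis using X L(1) by (simp add: power2_eq_iff_nonneg)
  qed
  moreover have "V t $ 1 * a $ 2 - V t $ 2 * a $ 1 = D 2 x * X ^ 3"
    unfolding inner_curvature_numerator[OF e] X_def[symmetric] Y_def[symmetric] a2 Y
    by (simp add: power3_eq_cube algebra_simps)
  ultimately have "curve_curvature \<gamma> t = D 2 x * X ^ 3 / (X * L) ^ 3"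
    by (simp add: curve_curvature_def V_def[symmetric] V_def[abs_def, symmetric] a_def[symmetric] Let_def)
  also have "\<dots> = D 2 x / L ^ 3" using X by (simp add: power_mult_distrib)
  finally show ?thesis by (simp add: L_def x_def)
qed

text \<open>Provides the existence part for \<open>boundary_curvature\<close>. The interior lies on
  the left because the height above the graph grows at rate 1 + f1^2 > 0 along the rotated
  velocity.\<close>

lemma graph_oriented_boundary_curve:
  fixes f :: "real \<Rightarrow> real"
  assumes chart: "graph_chart \<Omega> p e f r" and q: "frame 0 e (x, f x) \<in> ball p r"
  shows "oriented_boundary_curve \<Omega> (\<lambda>s. frame 0 e (s, f s)) x"
proof -
  have e: "norm e = 1" and f: "C_infinity f"
    and int: "\<And>z. z \<in> ball p r \<Longrightarrow> z \<in> interior \<Omega> \<longleftrightarrow> f (e \<bullet> z) < rot90 e \<bullet> z"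
    and fro: "\<And>z. z \<in> ball p r \<Longrightarrow> z \<in> frontier \<Omega> \<longleftrightarrow> f (e \<bullet> z) = rot90 e \<bullet> z"
    using chart by (auto simp: graph_chart_def)
  define f1 where "f1 = vector_derivative f (at x)"
  have f1: "(f has_real_derivative f1) (at x)"
    using C_infinity_has_vector_derivative[OF f, of 0 x]
    by (simp add: f1_def has_real_derivative_iff_has_vector_derivative)
  let ?\<gamma> = "\<lambda>s. frame 0 e (s, f s)"
  have eq: "?\<gamma> = (\<lambda>s. s *\<^sub>R e + f s *\<^sub>R rot90 e)" by (simp add: frame_def)
  have C: "C_infinity ?\<gamma>" unfolding eq by (intro C_infinity_linear_combination C_infinity_ident f)
  have "(?\<gamma> has_vector_derivative e + f1 *\<^sub>R rot90 e) (at x)"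
    unfolding eq using f1 by (auto intro!: derivative_eq_intros)
  then have V: "vector_derivative ?\<gamma> (at x) = e + f1 *\<^sub>R rot90 e" by (rule vector_derivative_at)
  have ee: "e \<bullet> e = 1" using e by (simp add: norm_eq_1)
  have "e \<bullet> (e + f1 *\<^sub>R rot90 e) = 1" by (simp add: inner_right_distrib ee)
  then have nz: "e + f1 *\<^sub>R rot90 e \<noteq> 0" by auto
  have "continuous_on UNIV f"
    using C_infinity_has_vector_derivative[OF f, of 0]
    by (auto intro!: continuous_at_imp_continuous_on has_vector_derivative_continuous)
  then have "continuous_on UNIV ?\<gamma>" unfolding eq by (intro continuous_intros)
  then have "isCont ?\<gamma> x" by (simp add: continuous_on_eq_continuous_at)
  then have "\<forall>\<^sub>F s in nhds x. ?\<gamma> s \<in> ball p r"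
    using q by (intro isCont_eventually_nhds) auto
  then have ev: "\<forall>\<^sub>F s in nhds x. ?\<gamma> s \<in> frontier \<Omega>"
    by eventually_elim (simp add: fro e)
  let ?\<psi> = "\<lambda>h. f x + h - f (x - h * f1)"
  have "(?\<psi> has_real_derivative 1 - f1 * (- f1)) (at 0)"
    using f1 by (auto intro!: derivative_eq_intros DERIV_chain2[of f f1])
  moreover have "0 < 1 - f1 * (- f1)" by (simp add: add_pos_nonneg)
  ultimately obtain d where d: "d > 0" "\<And>h. 0 < h \<Longrightarrow> h < d \<Longrightarrow> ?\<psi> 0 < ?\<psi> h"
    using DERIV_pos_inc_right[of ?\<psi> _ 0] by auto
  let ?n = "rot90 (e + f1 *\<^sub>R rot90 e)"
  have "((\<lambda>h. ?\<gamma> x + h *\<^sub>R ?n) \<longlongrightarrow> ?\<gamma> x + 0 *\<^sub>R ?n) (at_right 0)"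
    by (intro tendsto_intros)
  then have "\<forall>\<^sub>F h in at_right 0. ?\<gamma> x + h *\<^sub>R ?n \<in> ball p r"
    using q by (intro topological_tendstoD) auto
  moreover have "\<forall>\<^sub>F h in at_right 0. 0 < h \<and> h < d"
    by (rule eventually_at_rightI[OF _ d(1)]) simp
  ultimately have "\<forall>\<^sub>F h in at_right 0. ?\<gamma> x + h *\<^sub>R ?n \<in> interior \<Omega>"
  proof eventually_elim
    case (elim h)
    have "f (x - h * f1) < f x + h" using d(2)[of h] elim by simp
    then have "f (e \<bullet> (?\<gamma> x + h *\<^sub>R ?n)) < rot90 e \<bullet> (?\<gamma> x + h *\<^sub>R ?n)"
      by (simp add: inner_right_distrib inner_rot90_rot90[of e] e ee)
    then show ?case using int elim by blast
  qed
  with C nz ev show ?thesis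
    unfolding oriented_boundary_curve_def V by (intro conjI)
qed

text \<open>Shows that the definite description denotes: the graph itself is an admissible curve,
  and all admissible curves through the point yield the same number.\<close>

lemma boundary_curvature_graph:
  fixes f :: "real \<Rightarrow> real"
  assumes chart: "graph_chart \<Omega> p e f r" and q: "frame 0 e (x, f x) \<in> ball p r"
    and D: "D = (\<lambda>k. ((\<lambda>g s. vector_derivative g (at s)) ^^ k) f)"
  shows "boundary_curvature \<Omega> (frame 0 e (x, f x)) = D 2 x / sqrt (1 + (D 1 x)\<^sup>2) ^ 3"
proof -
  have e: "norm e = 1" using chart by (simp add: graph_chart_def)
  have 1: "curve_curvature \<gamma> t = D 2 x / sqrt (1 + (D 1 x)\<^sup>2) ^ 3"
    if "oriented_boundary_curve \<Omega> \<gamma> t" "\<gamma> t = frame 0 e (x, f x)" for \<gamma> t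
    using oriented_boundary_curve_curvature[OF chart _ that(1) D] that(2) q e by simp
  show ?thesis
    unfolding boundary_curvature_def
  proof (rule the_equality)
    show "\<exists>\<gamma> t. oriented_boundary_curve \<Omega> \<gamma> t \<and> \<gamma> t = frame 0 e (x, f x) \<and>
        D 2 x / sqrt (1 + (D 1 x)\<^sup>2) ^ 3 = curve_curvature \<gamma> t"
      using graph_oriented_boundary_curve[OF chart q] 1[OF graph_oriented_boundary_curve[OF chart q] refl]
      by (intro exI[of _ "\<lambda>s. frame 0 e (s, f s)"] exI[of _ x]) simp
  next
    fix k assume "\<exists>\<gamma> t. oriented_boundary_curve \<Omega> \<gamma> t \<and> \<gamma> t = frame 0 e (x, f x) \<and> k = curve_curvature \<gamma> t"
    then show "k = D 2 x / sqrt (1 + (D 1 x)\<^sup>2) ^ 3" using 1 by blast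
  qed
qed

section \<open>The asymptotic expansion\<close>

text \<open>The remainder \<open>R\<close> of the theorem with its abbreviations expanded.\<close>

definition potential_error :: "(real^2) set \<Rightarrow> real^2 \<Rightarrow> real" where
  "potential_error \<Omega> w = renormalized_potential w \<Omega>
     - (- (pi / (4 * (infdist w (frontier \<Omega>))\<^sup>2)
           + boundary_curvature \<Omega> (closest_point (frontier \<Omega>) w) * pi / (4 * infdist w (frontier \<Omega>))))"

lemma infdist_closest_point:
  fixes w :: "'a::{real_inner, heine_borel}"
  assumes "closed K" "K \<noteq> {}"
  shows "infdist w K = dist w (closest_point K w)"
proof (rule antisym)
  show "infdist w K \<le> dist w (closest_point K w)"
    using closest_point_in_set[OF assms] by (rule infdist_le)
  obtain x where "x \<in> K" "infdist w K = dist w x"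
    using infdist_attains_inf[OF assms] by blast
  then show "dist w (closest_point K w) \<le> infdist w K"
    using closest_point_le[OF assms(1)] by simp
qed

text \<open>The ball is connected and contains \<open>w\<close>; if it left the interior, it would
  meet the frontier at a distance below the minimal one.\<close>

lemma ball_infdist_frontier_subset_interior:
  fixes w :: "'a::real_normed_vector"
  assumes "w \<in> interior \<Omega>"
  shows "ball w (infdist w (frontier \<Omega>)) \<subseteq> interior \<Omega>"
proof (rule ccontr)
  assume neg: "\<not> ?thesis"
  let ?B = "ball w (infdist w (frontier \<Omega>))"
  obtain x where "dist w x < infdist w (frontier \<Omega>)" using neg by (meson mem_ball subsetI)
  then have "0 < infdist w (frontier \<Omega>)" using zero_le_dist[of w x] by linarith
  then have "w \<in> ?B" by simp
  then have "?B \<inter> frontier (interior \<Omega>) \<noteq> {}"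
    using neg assms by (intro connected_Int_frontier connected_ball) blast+
  then obtain z where "z \<in> ?B" "z \<in> frontier \<Omega>" using frontier_interior_subset by blast
  then show False using infdist_le[of z "frontier \<Omega>" w] by simp
qed

lemma C_infinity_derivatives_bounded:
  fixes f :: "real \<Rightarrow> real"
  assumes f: "C_infinity f" and D: "D = (\<lambda>k. ((\<lambda>g s. vector_derivative g (at s)) ^^ k) f)"
  obtains M where "1 \<le> M" "\<And>k x. k \<le> n \<Longrightarrow> a \<le> x \<Longrightarrow> x \<le> b \<Longrightarrow> \<bar>D k x\<bar> \<le> M"
proof -
  have "compact (D k ` {a..b})" for k
    unfolding D by (intro compact_continuous_image C_infinity_continuous f) simp
  then have "bounded (\<Union>k\<le>n. D k ` {a..b})" by (intro bounded_UN) (auto intro: compact_imp_bounded)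
  then obtain B where "\<forall>y \<in> (\<Union>k\<le>n. D k ` {a..b}). norm y \<le> B" unfolding bounded_iff by blast
  then show thesis by (intro that[of "max 1 B"]) (auto intro: max.coboundedI2)
qed

text \<open>One chart at \<open>p\<close> serves all \<open>w\<close> near \<open>p\<close>: the
  closest point \<open>q\<close> varies inside it, but the bound involves only \<open>M\<close> and
  \<rho>, chosen before \<open>w\<close>.\<close>

proposition potential_error_locally_bounded:
  assumes smooth: "smooth_boundary \<Omega>" and p: "p \<in> frontier \<Omega>"
  shows "\<exists>\<eta> N. 0 < \<eta> \<and> (\<forall>w \<in> interior \<Omega>. dist w p < \<eta> \<longrightarrow> \<bar>potential_error \<Omega> w\<bar> \<le> N)"
proof -
  obtain e f r where chart: "graph_chart \<Omega> p e f r"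
    using smooth p smooth_boundary_iff_graph_chart by blast
  then have r: "0 < r" and e: "norm e = 1" and f: "C_infinity f"
    and chart_int: "\<And>z. z \<in> ball p r \<Longrightarrow> z \<in> interior \<Omega> \<longleftrightarrow> f (e \<bullet> z) < rot90 e \<bullet> z"
    and chart_fro: "\<And>z. z \<in> ball p r \<Longrightarrow> z \<in> frontier \<Omega> \<longleftrightarrow> f (e \<bullet> z) = rot90 e \<bullet> z"
    by (auto simp: graph_chart_def)
  define D where "D = (\<lambda>k. ((\<lambda>g s. vector_derivative g (at s)) ^^ k) f)"
  \<comment> \<open>The interval from \<open>a\<close> to \<open>b\<close> contains the abscissas of
    all points within distance 1 of \<open>p\<close>; the derivatives are bounded on it.\<close>
  define a where "a = e \<bullet> p - 1"
  define b where "b = e \<bullet> p + 1"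
  obtain M where M: "1 \<le> M" "\<And>k x. k \<le> 4 \<Longrightarrow> a \<le> x \<Longrightarrow> x \<le> b \<Longrightarrow> \<bar>D k x\<bar> \<le> M"
    using C_infinity_derivatives_bounded[OF f D_def] by blast
  define C where "C = 884 * M ^ 10"
  have C: "1 \<le> C" using one_le_power[OF M(1), of 10] by (simp add: C_def)
  \<comment> \<open>The first entry is the smallness asked for by the estimates. The others keep the
    frame square about \<open>q\<close>, whose points are within 3 \<rho> of \<open>p\<close>,
    inside the chart and over the interval where \<open>M\<close> is valid.\<close>
  define \<rho> where "\<rho> = min (1 / (12 * C)) (min (r / 8) (1 / 8))"
  have \<rho>: "0 < \<rho>" "12 * C * \<rho> \<le> 1" "\<rho> \<le> r / 8" "\<rho> \<le> 1 / 8"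
  proof -
    have "12 * C * \<rho> \<le> 12 * C * (1 / (12 * C))" using C by (intro mult_left_mono) (auto simp: \<rho>_def)
    then show "12 * C * \<rho> \<le> 1" using C by simp
  qed (use C r in \<open>auto simp: \<rho>_def\<close>)
  have near: "e \<bullet> z \<in> {a..b}" if "dist z p \<le> 1" for z
  proof -
    have "\<bar>e \<bullet> (z - p)\<bar> \<le> 1" using Cauchy_Schwarz_ineq2[of e "z - p"] e that by (simp add: dist_norm)
    then show ?thesis by (auto simp: a_def b_def inner_diff_right)
  qed
  have "\<bar>potential_error \<Omega> w\<bar> \<le> 4 * pi / \<rho>\<^sup>2 + 1000 * C ^ 3 * (2 * \<rho> + pi) + 2 * C / \<rho>"
    if w: "w \<in> interior \<Omega>" "dist w p < \<rho> / 2" for w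
  proof -
    define q where "q = closest_point (frontier \<Omega>) w"
    define \<delta> where "\<delta> = infdist w (frontier \<Omega>)"
    have ne: "frontier \<Omega> \<noteq> {}" using p by auto
    have q: "q \<in> frontier \<Omega>" unfolding q_def by (rule closest_point_in_set[OF frontier_closed ne])
    have \<delta>q: "\<delta> = dist w q" unfolding \<delta>_def q_def by (rule infdist_closest_point[OF frontier_closed ne])
    have \<delta>_le: "\<delta> \<le> dist w z" if "z \<in> frontier \<Omega>" for z unfolding \<delta>_def using that by (rule infdist_le)
    have "w \<noteq> q" using w(1) q by (auto simp: frontier_def)
    then have \<delta>: "0 < \<delta>" "\<delta> \<le> \<rho> / 2" using \<delta>_le[OF p] w(2) by (auto simp: \<delta>q)
    have ball: "ball w \<delta> \<subseteq> interior \<Omega>" unfolding \<delta>_def by (rule ball_infdist_frontier_subset_interior[OF w(1)])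
    have qp: "dist q p < \<rho>"
      using dist_triangle[of q p w] \<delta> w(2) by (simp add: \<delta>q dist_commute)
    have q_ball: "q \<in> ball p r" using qp \<rho> by (simp add: dist_commute)
    define x0 where "x0 = e \<bullet> q"
    have x0: "a \<le> x0" "x0 \<le> b" using near[of q] qp \<rho> by (auto simp: x0_def)
    have fq: "rot90 e \<bullet> q = f x0" using chart_fro[OF q_ball] q by (simp add: x0_def)
    then have q_eq: "q = frame 0 e (x0, f x0)" using frame_expand[OF e, of q 0] by (simp add: x0_def)
    define f1 where "f1 = D 1 x0"
    define L where "L = sqrt (1 + f1\<^sup>2)"
    have L: "0 < L" "L\<^sup>2 = 1 + f1\<^sup>2" by (auto simp: L_def add_pos_nonneg)
    \<comment> \<open>The unit tangent in the direction of growing abscissa, so that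
      \<open>rot90 \<tau>\<close> points into the interior.\<close>
    define \<tau> where "\<tau> = (1 / L) *\<^sub>R (e + f1 *\<^sub>R rot90 e)"
    have ee: "e \<bullet> e = 1" using e by (simp add: norm_eq_1)
    have n: "rot90 \<tau> = (1 / L) *\<^sub>R (rot90 e - f1 *\<^sub>R e)"
      by (simp add: \<tau>_def vec_eq_iff forall_2 add_divide_distrib diff_divide_distrib)
    have \<tau>: "norm \<tau> = 1"
    proof -
      have "\<tau> \<bullet> \<tau> = (1 / L)\<^sup>2 * (1 + f1\<^sup>2)"
        by (simp add: \<tau>_def inner_left_distrib inner_right_distrib ee power2_eq_square add_divide_distrib)
      also have "\<dots> = 1" using L(1) by (simp add: L(2)[symmetric] power_divide)
      finally show ?thesis by (simp add: norm_eq_1)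
    qed
    \<comment> \<open>\<open>q\<close> minimizes the squared distance to \<open>w\<close> along the
      graph, so the derivative at \<open>x0\<close> vanishes; up to a factor it is the product of w
      - q with \<tau>.\<close>
    have perp: "\<tau> \<bullet> (w - q) = 0"
    proof -
      let ?h = "\<lambda>s. (s - e \<bullet> w)\<^sup>2 + (f s - rot90 e \<bullet> w)\<^sup>2"
      have h: "?h s = (dist w (frame 0 e (s, f s)))\<^sup>2" for s
        using norm_frame_coordinates[OF e, of "frame 0 e (s, f s) - w"] e
        by (simp add: inner_diff_right dist_norm norm_minus_commute)
      have "\<forall>\<^sub>F s in nhds x0. frame 0 e (s, f s) \<in> frontier \<Omega>"
        using graph_oriented_boundary_curve[OF chart, of x0] q_ball
        by (simp add: q_eq oriented_boundary_curve_def)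
      then obtain d where d: "0 < d" "\<And>s. dist s x0 < d \<Longrightarrow> frame 0 e (s, f s) \<in> frontier \<Omega>"
        unfolding eventually_nhds_metric by blast
      have "(f has_real_derivative f1) (at x0)"
        using C_infinity_has_vector_derivative[OF f, of 0 x0]
        by (simp add: f1_def D_def has_real_derivative_iff_has_vector_derivative)
      then have "(?h has_real_derivative 2 * (x0 - e \<bullet> w) + 2 * (f x0 - rot90 e \<bullet> w) * f1) (at x0)"
        by (auto intro!: derivative_eq_intros)
      moreover have "\<forall>s. \<bar>x0 - s\<bar> < d \<longrightarrow> ?h x0 \<le> ?h s"
      proof (intro allI impI)
        fix s assume "\<bar>x0 - s\<bar> < d"
        then have "dist w q \<le> dist w (frame 0 e (s, f s))"
          using d(2)[of s] \<delta>_le \<delta>q by (simp add: dist_real_def abs_minus_commute)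
        then show "?h x0 \<le> ?h s" unfolding h q_eq[symmetric] by (intro power_mono) auto
      qed
      ultimately have "2 * (x0 - e \<bullet> w) + 2 * (f x0 - rot90 e \<bullet> w) * f1 = 0"
        using DERIV_local_min d(1) by blast
      then have "(e \<bullet> w - x0) + f1 * (rot90 e \<bullet> w - f x0) = 0" by (simp add: algebra_simps)
      moreover have "\<tau> \<bullet> (w - q) = 1 / L * ((e \<bullet> w - x0) + f1 * (rot90 e \<bullet> w - f x0))"
        unfolding \<tau>_def inner_scaleR_left inner_add_left inner_diff_right fq x0_def[symmetric]
        by (simp add: algebra_simps flip: diff_divide_distrib)
      ultimately show ?thesis by simp
    qed
    define A where "A = D 2 x0 / (2 * L ^ 3)"
    define c where "c = D 3 x0 / (6 * L ^ 4) - 2 * A\<^sup>2 * f1"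
    have Mk: "\<bar>f1\<bar> \<le> M" "\<bar>D 2 x0\<bar> \<le> M" "\<bar>D 3 x0\<bar> \<le> M" using M(2) x0 by (auto simp: f1_def)
    have sandwich: "(A * u\<^sup>2 + c * u ^ 3 + C * u ^ 4 < v \<longrightarrow> frame q \<tau> (u, v) \<in> interior \<Omega>) \<and>
        (v < A * u\<^sup>2 + c * u ^ 3 - C * u ^ 4 \<longrightarrow> frame q \<tau> (u, v) \<notin> interior \<Omega>)"
      if u: "\<bar>u\<bar> \<le> \<rho>" and v: "\<bar>v\<bar> \<le> \<rho>" for u v
    proof -
      let ?z = "frame q \<tau> (u, v)"
      define t where "t = (u - f1 * v) / L"
      have ez: "e \<bullet> ?z = x0 + t"
        by (simp add: frame_def n) (simp add: \<tau>_def inner_right_distrib inner_diff_right ee x0_def t_def diff_divide_distrib mult.commute)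
      have nz: "rot90 e \<bullet> ?z = f x0 + (f1 * u + v) / L"
        by (simp add: frame_def n) (simp add: \<tau>_def inner_right_distrib inner_diff_right ee fq add_divide_distrib mult.commute)
      have "norm (u, v) \<le> \<bar>u\<bar> + \<bar>v\<bar>" using norm_Pair_le[of u v] by simp
      moreover have "dist ?z q = norm (u, v)"
        using dist_frame[OF \<tau>, of q "(u, v)" "(0, 0)"] by (simp add: dist_norm frame_def)
      ultimately have zp: "dist ?z p < 3 * \<rho>" using dist_triangle[of ?z p q] qp u v by linarith
      have z_ball: "?z \<in> ball p r" using zp \<rho> by (simp add: dist_commute)
      have zab: "a \<le> x0 + t" "x0 + t \<le> b" using near[of ?z] zp \<rho> by (auto simp: ez)
      define R where "R = f (x0 + t) - (f x0 + f1 * t + D 2 x0 / 2 * t\<^sup>2 + D 3 x0 / 6 * t ^ 3)"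
      have R: "\<bar>R\<bar> \<le> M * t ^ 4"
        using C_infinity_Taylor3[OF f D_def x0 zab M(2)] by (simp add: R_def f1_def)
      have \<Phi>: "rot90 e \<bullet> ?z - f (e \<bullet> ?z) = (f1 * u + v) / L - (f1 * t + D 2 x0 / 2 * t\<^sup>2 + D 3 x0 / 6 * t ^ 3 + R)"
        unfolding ez nz by (simp add: R_def)
      note G = graph_in_tangent_frame[OF M(1) Mk \<rho>(2)[unfolded C_def] u v, folded L_def, folded t_def, OF R,
          folded A_def, folded c_def C_def, folded \<Phi>]
      show ?thesis using G(3,4) chart_int[OF z_ball] by auto
    qed
    \<comment> \<open>These two bounds do not depend on the point of the frame, so the origin with
      remainder 0 is inserted.\<close>
    have AC: "\<bar>A\<bar> \<le> C" "\<bar>c\<bar> \<le> C"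
      using graph_in_tangent_frame(1,2)[OF M(1) Mk \<rho>(2)[unfolded C_def], of 0 0 0] \<rho>(1)
      by (simp_all add: A_def c_def L_def C_def)
    define v where "v = rot90 \<tau> \<bullet> (w - q)"
    have w_v: "w = frame q \<tau> (0, v)" using frame_expand[OF \<tau>, of w q] perp by (simp add: v_def)
    have absv: "\<bar>v\<bar> = \<delta>"
      using dist_frame[OF \<tau>, of q "(0, v)" "(0, 0)"] by (simp add: \<delta>q dist_norm w_v[symmetric] frame_def[of q \<tau> "(0, 0)"])
    \<comment> \<open>At u = 0 the sandwich says that negative heights lie outside the interior, so
      \<open>w\<close> is on the inner half of the normal.\<close>
    have "\<not> v < 0" using sandwich[of 0 v] absv \<delta> \<rho>(1) w(1) by (auto simp: w_v[symmetric])
    then have w_eq: "w = frame q \<tau> (0, \<delta>)" using absv w_v by simp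
    define S where "S = frame q \<tau> -` (- interior \<Omega>)"
    have S: "S \<in> sets borel"
      using measurable_sets[OF measurable_frame, of "- interior \<Omega>" q \<tau>] by (simp add: S_def)
    have far: "S \<inter> ball (0, \<delta>) \<delta> = {}"
    proof -
      have "frame q \<tau> z \<in> ball w \<delta>" if "z \<in> ball (0, \<delta>) \<delta>" for z
        using that dist_frame[OF \<tau>, of q "(0, \<delta>)" z] by (simp add: w_eq dist_norm)
      then show ?thesis using ball by (auto simp: S_def simp del: mem_ball)
    qed
    have V: "renormalized_potential w \<Omega> = - (\<integral>z. indicator S z * (1 / norm (z - (0, \<delta>)) ^ 4) \<partial>lborel)"
    proof -
      have "renormalized_potential w \<Omega> = - (\<integral>z. indicator (- interior \<Omega>) z * (1 / norm (z - w) ^ 4) \<partial>lborel)"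
        by (rule renormalized_potential_eq_exterior[OF smooth_boundary_imp_negligible_frontier[OF smooth] \<delta>(1) ball])
      also have "(\<integral>z. indicator (- interior \<Omega>) z * (1 / norm (z - w) ^ 4) \<partial>lborel)
          = (\<integral>z. indicator S z * (1 / norm (z - (0, \<delta>)) ^ 4) \<partial>lborel)"
        unfolding w_eq S_def by (rule integral_exterior_frame[OF \<tau>]) simp
      finally show ?thesis .
    qed
    have \<kappa>: "boundary_curvature \<Omega> q = 2 * A"
      using boundary_curvature_graph[OF chart _ D_def, of x0] q_ball
      by (simp add: q_eq[symmetric] A_def L_def f1_def)
    have "\<bar>(\<integral>z. indicator S z * (1 / norm (z - (0, \<delta>)) ^ 4) \<partial>lborel) - (pi / (4 * \<delta>\<^sup>2) + A * pi / (2 * \<delta>))\<bar>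
       \<le> 4 * pi / \<rho>\<^sup>2 + 1000 * C ^ 3 * (2 * \<rho> + pi) + 2 * C / \<rho>"
      by (rule quartic_potential_of_near_parabolic_region[OF C \<rho>(1,2) \<delta> AC S far])
        (use sandwich in \<open>auto simp: S_def\<close>)
    moreover have "potential_error \<Omega> w = - ((\<integral>z. indicator S z * (1 / norm (z - (0, \<delta>)) ^ 4) \<partial>lborel) - (pi / (4 * \<delta>\<^sup>2) + A * pi / (2 * \<delta>)))"
      unfolding potential_error_def q_def[symmetric] \<delta>_def[symmetric] V \<kappa> by simp
    ultimately show ?thesis by simp
  qed
  moreover have "0 < \<rho> / 2" using \<rho>(1) by simp
  ultimately show ?thesis by blast
qed

lemma potential_error_uniformly_bounded:
  assumes smooth: "smooth_boundary \<Omega>" and K: "compact (frontier \<Omega>)"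
  shows "\<exists>\<eta> N. 0 < \<eta> \<and> (\<forall>w \<in> interior \<Omega>. 0 < infdist w (frontier \<Omega>) \<longrightarrow> infdist w (frontier \<Omega>) < \<eta>
     \<longrightarrow> \<bar>potential_error \<Omega> w\<bar> \<le> N)"
proof (cases "frontier \<Omega> = {}")
  case True
  \<comment> \<open>The distance to the empty set is 0 by convention, so no \<open>w\<close>
    satisfies the positivity hypothesis.\<close>
  then show ?thesis by (intro exI[of _ 1]) (simp add: infdist_def)
next
  case False
  obtain \<eta> N where \<eta>: "\<And>p. p \<in> frontier \<Omega> \<Longrightarrow> 0 < \<eta> p"
    and N: "\<And>p w. p \<in> frontier \<Omega> \<Longrightarrow> w \<in> interior \<Omega> \<Longrightarrow> dist w p < \<eta> p \<Longrightarrow> \<bar>potential_error \<Omega> w\<bar> \<le> N p"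
    using potential_error_locally_bounded[OF smooth] by metis
  obtain F where F: "F \<subseteq> frontier \<Omega>" "finite F" "frontier \<Omega> \<subseteq> (\<Union>p\<in>F. ball p (\<eta> p))"
    by (rule compactE_image[OF K, of "frontier \<Omega>" "\<lambda>p. ball p (\<eta> p)"]) (use \<eta> in force)+
  \<comment> \<open>A Lebesgue number of the finite cover: a point \<open>w\<close> within
    \<epsilon> of its closest \<open>q\<close> falls into a single one of the balls, so the maximum
    of finitely many local bounds applies.\<close>
  obtain \<epsilon> where \<epsilon>: "0 < \<epsilon>" "\<And>x. x \<in> frontier \<Omega> \<Longrightarrow> \<exists>G \<in> (\<lambda>p. ball p (\<eta> p)) ` F. ball x \<epsilon> \<subseteq> G"
    by (rule Heine_Borel_lemma[OF K, of "(\<lambda>p. ball p (\<eta> p)) ` F"]) (use F in auto)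
  have "\<bar>potential_error \<Omega> w\<bar> \<le> Max (N ` F)" if w: "w \<in> interior \<Omega>" "infdist w (frontier \<Omega>) < \<epsilon>" for w
  proof -
    obtain q where q: "q \<in> frontier \<Omega>" "infdist w (frontier \<Omega>) = dist w q"
      using infdist_attains_inf[OF frontier_closed False] by blast
    then obtain p where p: "p \<in> F" "ball q \<epsilon> \<subseteq> ball p (\<eta> p)" using \<epsilon>(2) by blast
    have "w \<in> ball q \<epsilon>" using q w(2) by (simp add: dist_commute)
    then have "dist w p < \<eta> p" using p(2) by (auto simp: dist_commute)
    then have "\<bar>potential_error \<Omega> w\<bar> \<le> N p" using N p(1) F(1) w(1) by blast
    also have "\<dots> \<le> Max (N ` F)" using p(1) F(2) by simp
    finally show ?thesis .
  qed
  then show ?thesis using \<epsilon>(1) by blast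
qed

text \<open>The local constants depend on the boundary point, hence a statement at each point and a
  uniform one for compact boundary. In the latter, \<open>at_right 0\<close> supplies the positivity
  of the distance, which also settles an empty frontier.\<close>

theorem proposition4p4:
  fixes \<Omega> :: "(real^2) set"
  assumes "smooth_boundary \<Omega>"
  shows "let K = frontier \<Omega>;
             \<delta> = (\<lambda>w. infdist w K);
             \<kappa> = (\<lambda>w. boundary_curvature \<Omega> (closest_point K w));
             R = (\<lambda>w. renormalized_potential w \<Omega>
                    - (- (pi / (4 * (\<delta> w)\<^sup>2) + \<kappa> w * pi / (4 * \<delta> w))))
         in (\<forall>p\<in>K. R \<in> O[at p within interior \<Omega>](\<lambda>_. 1)) \<and>
            (compact K \<longrightarrow>
              R \<in> O[inf (filtercomap \<delta> (at_right 0)) (principal (interior \<Omega>))](\<lambda>_. 1))"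
  unfolding Let_def potential_error_def[symmetric]
proof (intro conjI ballI impI)
  fix p assume "p \<in> frontier \<Omega>"
  then obtain \<eta> N where "0 < \<eta>" and N: "\<And>w. w \<in> interior \<Omega> \<Longrightarrow> dist w p < \<eta> \<Longrightarrow> \<bar>potential_error \<Omega> w\<bar> \<le> N"
    using potential_error_locally_bounded[OF assms] by blast
  then have "\<forall>\<^sub>F w in at p within interior \<Omega>. norm (potential_error \<Omega> w) \<le> N * norm (1 :: real)"
    unfolding eventually_at by auto
  then show "(\<lambda>w. potential_error \<Omega> w) \<in> O[at p within interior \<Omega>](\<lambda>_. 1)" by (rule bigoI)
next
  assume "compact (frontier \<Omega>)"
  then obtain \<eta> N where \<eta>: "0 < \<eta>" and N: "\<And>w. w \<in> interior \<Omega> \<Longrightarrow> 0 < infdist w (frontier \<Omega>) \<Longrightarrow> infdist w (frontier \<Omega>) < \<eta>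
     \<Longrightarrow> \<bar>potential_error \<Omega> w\<bar> \<le> N"
    using potential_error_uniformly_bounded[OF assms] by blast
  have "\<forall>\<^sub>F d in at_right 0. 0 < d \<and> d < \<eta>" by (rule eventually_at_rightI[OF _ \<eta>]) simp
  then have "\<forall>\<^sub>F w in filtercomap (\<lambda>w. infdist w (frontier \<Omega>)) (at_right 0).
      0 < infdist w (frontier \<Omega>) \<and> infdist w (frontier \<Omega>) < \<eta>"
    by (rule eventually_filtercomapI)
  then have "\<forall>\<^sub>F w in inf (filtercomap (\<lambda>w. infdist w (frontier \<Omega>)) (at_right 0)) (principal (interior \<Omega>)).
      norm (potential_error \<Omega> w) \<le> N * norm (1 :: real)"
    unfolding eventually_inf_principal by eventually_elim (simp add: N)
  then show "(\<lambda>w. potential_error \<Omega> w) \<in> O[inf (filtercomap (\<lambda>w. infdist w (frontier \<Omega>)) (at_right 0)) (principal (interior \<Omega>))](\<lambda>_. 1)"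
    by (rule bigoI)
qed

end
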